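(* Let $\mathcal{Q}\subseteq\mathbb{C}[x_1,x_2]$ be a set of polynomials such that $\mathbb{C}[x_1,x_2]$ is the linear span of the polynomials $p(x_1)q(x_1,x_2)$, where $p\in\mathbb{C}[x_1]$ and $q\in\mathcal{Q}$. Suppose that $L$ is a positive linear functional on $\mathbb{C}[x_1,x_2]$ such that for each $q\in\mathcal{Q}$ the (positive) linear functional $$L_q(p):=L\big(p(x_1)(x_2^2+1)q\overline{q}\big),\qquad p\in\mathbb{C}[x_1],$$ on $\mathbb{C}[x_1]$ is determinate. Then $L$ is a moment functional.
   Context: $\mathbb{C}[x_1,\dots,x_d]$ is regarded as a $*$-algebra with involution $p\mapsto\overline p$ (complex conjugation of coefficients, variables being hermitian). A linear functional $L$ on $\mathbb{C}[x_1,\dots,x_d]$ is positive if $L(p\overline p)\ge 0$ for all $p$. $\mathcal{M}(\mathbb{R}^d)$ is the set of positive Borel measures on $\mathbb{R}^d$ having all moments finite. $L$ is a moment functional if there is $\mu\in\mathcal{M}(\mathbb{R}^d)$ with $L(p)=\int p\,d\mu$ for all $p\in\mathbb{C}[x_1,\dots,x_d]$; it is determinate if there is exactly one such $\mu$. (Every positive linear functional on $\mathbb{C}[x_1]$ is a moment functional.) *)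

theory Defs
  imports "HOL-Analysis.Analysis" "HOL-Computational_Algebra.Polynomial"
begin

text \<open>
  The algebra $C[x_1, x_2]$ is represented by \<^typ>\<open>complex poly poly\<close> as $C[x_1][x_2]$:
  the variable of the coefficient ring is $x_1$, the outer variable is $x_2$.
\<close>

definition x1_poly :: "complex poly \<Rightarrow> complex poly poly" where
  "x1_poly p = [:p:]"

definition X2 :: "complex poly poly" where
  "X2 = [:0, 1:]"

definition scale2 :: "complex \<Rightarrow> complex poly poly \<Rightarrow> complex poly poly" where
  "scale2 c f = smult [:c:] f"

definition conj2 :: "complex poly poly \<Rightarrow> complex poly poly" where
  "conj2 f = map_poly (map_poly cnj) f"

definition eval2 :: "complex poly poly \<Rightarrow> real \<times> real \<Rightarrow> complex" where
  "eval2 f z = poly (poly f [:complex_of_real (snd z):]) (complex_of_real (fst z))"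

lemma vector_space_scale2: "vector_space scale2"
  by unfold_locales
    (simp_all add: scale2_def smult_add_right mult.commute flip: smult_add_left one_pCons)

lemma vector_space_times_complex: "vector_space ((*) :: complex \<Rightarrow> complex \<Rightarrow> complex)"
  by unfold_locales (simp_all add: algebra_simps)

lemma eval2_simps [simp]:
  "eval2 (x1_poly p) (s, t) = poly p (complex_of_real s)"
  "eval2 X2 (s, t) = complex_of_real t"
  "eval2 (scale2 c f) z = c * eval2 f z"
  "eval2 (f + g) z = eval2 f z + eval2 g z"
  "eval2 (f * g) z = eval2 f z * eval2 g z"
  by (simp_all add: eval2_def x1_poly_def X2_def scale2_def)

lemma eval2_conj2: "eval2 (conj2 f) z = cnj (eval2 f z)"
proof -
  have cnj_poly: "poly (map_poly cnj p) (complex_of_real s) = cnj (poly p (complex_of_real s))" for p s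
    by (induction p) (simp_all add: map_poly_pCons)
  show ?thesis
    unfolding conj2_def eval2_def
    by (induction f) (simp_all add: map_poly_pCons cnj_poly)
qed

definition positive_functional :: "(complex poly poly \<Rightarrow> complex) \<Rightarrow> bool" where
  "positive_functional L \<longleftrightarrow> (\<forall>f. L (f * conj2 f) \<in> \<real>\<^sub>\<ge>\<^sub>0)"

definition finite_moment_measures1 :: "real measure set" where
  "finite_moment_measures1 =
     {\<mu>. sets \<mu> = sets borel \<and> (\<forall>n. integrable \<mu> (\<lambda>x. x ^ n))}"

definition finite_moment_measures2 :: "(real \<times> real) measure set" where
  "finite_moment_measures2 =
     {\<mu>. sets \<mu> = sets borel \<and> (\<forall>m n. integrable \<mu> (\<lambda>z. fst z ^ m * snd z ^ n))}"

definition represents1 :: "real measure \<Rightarrow> (complex poly \<Rightarrow> complex) \<Rightarrow> bool" where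
  "represents1 \<mu> L \<longleftrightarrow>
     \<mu> \<in> finite_moment_measures1 \<and> (\<forall>p. L p = (LINT x|\<mu>. poly p (complex_of_real x)))"

definition represents2 :: "(real \<times> real) measure \<Rightarrow> (complex poly poly \<Rightarrow> complex) \<Rightarrow> bool" where
  "represents2 \<mu> L \<longleftrightarrow>
     \<mu> \<in> finite_moment_measures2 \<and> (\<forall>f. L f = (LINT z|\<mu>. eval2 f z))"

definition determinate1 :: "(complex poly \<Rightarrow> complex) \<Rightarrow> bool" where
  "determinate1 L \<longleftrightarrow> (\<exists>!\<mu>. represents1 \<mu> L)"

definition moment_functional2 :: "(complex poly poly \<Rightarrow> complex) \<Rightarrow> bool" where
  "moment_functional2 L \<longleftrightarrow> (\<exists>\<mu>. represents2 \<mu> L)"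

end

theory Submission
  imports Defs
    "HOL-Probability.Probability"
    "HOL-Real_Asymp.Real_Asymp"
    "HOL-Computational_Algebra.Fundamental_Theorem_Algebra"
begin

text \<open>
The operator picture behind the theorem is this. On the space $C[x_1,x_2]$ with the form
$\langle f,g\rangle = L(f\overline{g})$ the multiplications by $x_1$ and $x_2$ are commuting symmetric
operators. Determinacy of the functionals $L_q$ makes multiplication by $x_1$ essentially self-adjoint
even with respect to the stronger form $L((x_2^2+1)f\overline{g})$; then the spectral measure of $x_1$
commutes with $x_2$, so that over each small piece of the $x_1$-axis only a one-variable moment problem
in $x_2$ remains, and that one is always solvable. The proof below runs this argument without Hilbert
space completions, spectral theorem or disintegration.

\<^item> \<^emph>\<open>Determinacy gives density.\<close> If $l$ on $C[x]$ is determinate, some polynomial $g$ with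
$g(\mathrm{i})=1$ has $l(g\overline{g})$ as small as desired (\<open>determinate_approximation\<close>). Indeed, with
$\mu$ the representing measure and $d\mu/(1+x^2)$ giving the functional $l''$, every perturbation
$l''+a\,\mathrm{ev}_{\mathrm{i}}+\overline{a}\,\mathrm{ev}_{-\mathrm{i}}$ with $a\ne 0$ still sends
$(1+x^2)p$ to $l(p)$; if it is positive, Hamburger's theorem turns it into another measure for $l$. So no
such perturbation is positive, and a separation argument in the plane produces $g$. Applied to the $L_q$ this
says that $(x_1-\mathrm{i})h$ approximates every $f$ in the seminorm of $L((x_2^2+1)\,\cdot\,)$
(\<open>resolvent_dense_if_determinate\<close>).

\<^item> \<^emph>\<open>Density adjoins the resolvent.\<close> If $(x_1-\mathrm{i})h_n\to f$ and $(x_1-\mathrm{i})k_n\to g$,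
then $\lim L(h_n\overline{k_n})$ depends only on $f\overline{g}$ and defines the positive functional
$f \mapsto L(f/(x_1^2+1))$, which has the same density property (\<open>adjoin_resolvent\<close>). The
weight $x_2^2+1$ is what makes the limit compatible with multiplication by $x_2$. Iteration gives
$L(f/(x_1^2+1)^n)$ for all $n$.

\<^item> \<^emph>\<open>Denominators give a partition of unity.\<close> The Cayley transform sends the $x_1$-axis to the unit
circle. Fejer kernels centred at roots of $-1$ are squares of moduli of polynomials in $x_1$ divided
by a power of $x_1^2+1$, and they sum to a constant. Multiplying by one of them and
keeping only $x_2$ gives a positive functional on $C[x_2]$, which Gauss quadrature represents by atoms up
to any given degree (\<open>gauss_quadrature\<close>). Putting these atoms over the centre of the kernel
gives finite measures in the plane whose moments converge to those of $L$
(\<open>atomic_approximation\<close>), because the kernels only damp Fourier coefficients.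

\<^item> \<^emph>\<open>Compactness.\<close> A pointwise limit of moment arrays of finite atomic measures in the plane is again a moment
array (\<open>limit_of_atomic_measures\<close>). Lifting the atoms to the unit interval along Schoenberg's
space-filling curve reduces this to Helly's selection theorem on the line. The same
statement, with Gauss quadrature, gives Hamburger's theorem.
\<close>

section \<open>Positive functionals on commutative star-algebras\<close>

text \<open>
Positivity is used for functionals on $C[x]$ and on $C[x_1,x_2]$; the consequences needed,
hermitian symmetry and the Cauchy-Schwarz inequality, only involve the star-algebra structure. Scalars
enter through their embedding \<open>const\<close> because the ring \<^typ>\<open>complex poly poly\<close> carries no complex scalar
multiplication of its own.
\<close>

locale star_functional =
  fixes const :: "complex \<Rightarrow> 'a::comm_ring_1"
    and star :: "'a \<Rightarrow> 'a"
    and L :: "'a \<Rightarrow> complex"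
  assumes const_1: "const 1 = 1"
    and star_const: "star (const c) = const (cnj c)"
    and star_add: "star (f + g) = star f + star g"
    and star_mult: "star (f * g) = star f * star g"
    and star_star: "star (star f) = f"
    and add: "L (f + g) = L f + L g"
    and scale: "L (const c * f) = c * L f"
    and pos: "L (f * star f) \<in> \<real>\<^sub>\<ge>\<^sub>0"
begin

lemma zero [simp]: "L 0 = 0"
  using add[of 0 0] by simp

lemma minus: "L (- f) = - L f"
  using add[of f "- f"] by (simp add: eq_neg_iff_add_eq_0 add.commute)

lemma diff: "L (f - g) = L f - L g"
  using add[of f "- g"] by (simp add: minus)

lemma sum: "L (sum f A) = (\<Sum>a\<in>A. L (f a))"
  by (induction A rule: infinite_finite_induct) (auto simp: add)

lemma star_0 [simp]: "star 0 = 0"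
  using star_add[of 0 0] by simp

lemma star_1 [simp]: "star 1 = 1"
  using star_const[of 1] by (simp add: const_1)

lemma star_minus: "star (- f) = - star f"
  using star_add[of f "- f"] by (simp add: eq_neg_iff_add_eq_0 add.commute)

lemma star_diff: "star (f - g) = star f - star g"
  using star_add[of f "- g"] by (simp add: star_minus)

lemma pos_Im: "Im (L (f * star f)) = 0" and pos_Re: "Re (L (f * star f)) \<ge> 0"
  using pos[of f] by (auto simp: complex_nonneg_Reals_iff)

text \<open>
Polarization: positivity makes the form real on the diagonal, and expanding it at $f+g$ and at
$f-\mathrm{i}g$ yields the imaginary and the real part of the claim.
\<close>

lemma hermitian_form: "L (g * star f) = cnj (L (f * star g))"
proof -
  have "L ((f + g) * star (f + g)) = L (f * star f) + L (g * star g) + L (f * star g) + L (g * star f)"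
    by (simp add: star_add algebra_simps add)
  then have 1: "Im (L (f * star g)) + Im (L (g * star f)) = 0"
    using pos_Im[of f] pos_Im[of g] pos_Im[of "f + g"] by simp
  have "(f + const (-\<i>) * g) * star (f + const (-\<i>) * g) = f * star f + const (-\<i>) * (const \<i> * (g * star g))
     + const \<i> * (f * star g) + const (-\<i>) * (g * star f)"
    by (simp add: star_add star_mult star_const algebra_simps)
  then have "L ((f + const (-\<i>) * g) * star (f + const (-\<i>) * g)) = L (f * star f) + L (g * star g)
     + \<i> * L (f * star g) - \<i> * L (g * star f)"
    by (simp only: add scale) simp
  then have 2: "Re (L (f * star g)) - Re (L (g * star f)) = 0"
    using pos_Im[of f] pos_Im[of g] pos_Im[of "f + const (-\<i>) * g"] by simp
  show ?thesis using 1 2 by (simp add: complex_eq_iff)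
qed

lemma hermitian: "L (star f) = cnj (L f)"
  using hermitian_form[of 1 f] by simp

text \<open>
Only a seminorm: it vanishes on the left kernel of the functional.
\<close>

definition nrm :: "'a \<Rightarrow> real" where
  "nrm f = sqrt (Re (L (f * star f)))"

lemma nrm_nonneg [simp]: "nrm f \<ge> 0"
  by (simp add: nrm_def pos_Re)

lemma nrm_sq: "(nrm f)\<^sup>2 = Re (L (f * star f))"
  by (simp add: nrm_def pos_Re)

lemma L_star_self: "L (f * star f) = complex_of_real ((nrm f)\<^sup>2)"
  by (simp add: nrm_sq complex_eq_iff pos_Im)

lemma nrm_0 [simp]: "nrm 0 = 0"
  by (simp add: nrm_def)

theorem Cauchy_Schwarz: "cmod (L (f * star g)) \<le> nrm f * nrm g"
proof -
  define c where "c = L (f * star g)"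
  define F where "F = (nrm f)\<^sup>2"
  define G where "G = (nrm g)\<^sup>2"
  have FG: "F \<ge> 0" "G \<ge> 0" by (simp_all add: F_def G_def)
  \<comment> \<open>The square of the seminorm of f - r c g as a quadratic polynomial in the real number r.\<close>
  have key: "0 \<le> F - 2 * r * (cmod c)\<^sup>2 + r\<^sup>2 * (cmod c)\<^sup>2 * G" for r :: real
  proof -
    define t where "t = complex_of_real r * c"
    have "(f - const t * g) * star (f - const t * g) =
      f * star f - const (cnj t) * (f * star g) - const t * (g * star f) + const t * (const (cnj t) * (g * star g))"
      by (simp add: star_diff star_mult star_const algebra_simps)
    then have "L ((f - const t * g) * star (f - const t * g)) = L (f * star f) - cnj t * c - t * cnj c + t * (cnj t * L (g * star g))"
      by (simp add: add diff scale c_def hermitian_form[of g f])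
    moreover have "Re (cnj t * c) = r * (cmod c)\<^sup>2" "Re (t * cnj c) = r * (cmod c)\<^sup>2"
      "t * (cnj t * L (g * star g)) = complex_of_real (r\<^sup>2 * (cmod c)\<^sup>2 * G)"
      by (simp_all add: t_def cmod_power2 power2_eq_square[of "Re c"] power2_eq_square[of "Im c"] algebra_simps)
        (simp add: L_star_self G_def complex_mult_cnj cmod_power2 power2_eq_square algebra_simps complex_eq_iff)
    ultimately show ?thesis
      using pos_Re[of "f - const t * g"] by (simp add: F_def nrm_sq)
  qed
  have "(cmod c)\<^sup>2 \<le> F * G"
  proof (cases "G = 0")
    case True
    show ?thesis
    proof (rule ccontr)
      assume "\<not> ?thesis"
      then have "c \<noteq> 0" using True by auto
      then show False using key[of "(F + 1) / (2 * (cmod c)\<^sup>2)"] True FG by (simp add: field_simps)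
    qed
  next
    case False
    then show ?thesis using key[of "1 / G"] FG by (simp add: field_simps power2_eq_square)
  qed
  then have "(cmod c)\<^sup>2 \<le> (nrm f * nrm g)\<^sup>2" by (simp add: F_def G_def power_mult_distrib)
  then show ?thesis unfolding c_def by (rule power2_le_imp_le) simp
qed

lemma nrm_triangle: "nrm (f + g) \<le> nrm f + nrm g"
proof (rule power2_le_imp_le)
  have "L ((f + g) * star (f + g)) = L (f * star f) + L (g * star g) + (L (f * star g) + cnj (L (f * star g)))"
    by (simp add: star_add algebra_simps add flip: hermitian_form) 
  then have "(nrm (f + g))\<^sup>2 = (nrm f)\<^sup>2 + (nrm g)\<^sup>2 + 2 * Re (L (f * star g))"
    by (simp add: nrm_sq)
  also have "\<dots> \<le> (nrm f)\<^sup>2 + (nrm g)\<^sup>2 + 2 * (nrm f * nrm g)"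
    using Cauchy_Schwarz[of f g] complex_Re_le_cmod[of "L (f * star g)"] by simp
  finally show "(nrm (f + g))\<^sup>2 \<le> (nrm f + nrm g)\<^sup>2" by (simp add: power2_sum)
qed simp

lemma nrm_minus: "nrm (- f) = nrm f"
  by (simp add: nrm_def star_minus)

lemma nrm_triangle_diff: "nrm (f - g) \<le> nrm f + nrm g"
  using nrm_triangle[of f "- g"] by (simp add: nrm_minus)

lemma nrm_minus_commute: "nrm (f - g) = nrm (g - f)"
  using nrm_minus[of "f - g"] by simp

lemma nrm_scale: "nrm (const c * f) = cmod c * nrm f"
proof -
  have "(const c * f) * star (const c * f) = const c * (const (cnj c) * (f * star f))"
    by (simp add: star_mult star_const algebra_simps)
  then have "L ((const c * f) * star (const c * f)) = complex_of_real ((cmod c * nrm f)\<^sup>2)"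
    by (simp add: scale L_star_self complex_norm_square power_mult_distrib mult.assoc del: of_real_power flip: of_real_mult)
      (metis complex_norm_square mult.assoc of_real_mult of_real_power)
  then show ?thesis unfolding nrm_def
    by (metis Re_complex_of_real abs_of_nonneg mult_nonneg_nonneg norm_ge_zero nrm_nonneg real_sqrt_abs nrm_def)
qed

lemma eq_0_if_nrm_0: "nrm f = 0 \<Longrightarrow> L (f * g) = 0"
  using Cauchy_Schwarz[of f "star g"] by (simp add: star_star)

end

subsection \<open>The two polynomial algebras\<close>

lemma map_poly_add_hom:
  assumes "f 0 = 0" "\<And>a b. f (a + b) = f a + f b"
  shows "map_poly f (p + q) = map_poly f p + map_poly f q"
  by (rule poly_eqI) (simp add: coeff_map_poly assms)

lemma map_poly_mult_hom:
  fixes f :: "'a::comm_ring_1 \<Rightarrow> 'b::comm_ring_1"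
  assumes f: "f 0 = 0" "\<And>a b. f (a + b) = f a + f b" "\<And>a b. f (a * b) = f a * f b"
  shows "map_poly f (p * q) = map_poly f p * map_poly f q"
proof (induction p)
  case (pCons a p)
  have "map_poly f (pCons a p * q) = map_poly f (smult a q) + map_poly f (pCons 0 (p * q))"
    by (simp add: map_poly_add_hom[OF f(1,2)])
  then show ?case using pCons by (simp add: map_poly_pCons f map_poly_smult)
qed simp

abbreviation "conj1 \<equiv> map_poly cnj"

lemma conj1_add: "conj1 (p + q) = conj1 p + conj1 q"
  by (simp add: map_poly_add_hom)

lemma conj1_mult: "conj1 (p * q) = conj1 p * conj1 q"
  by (simp add: map_poly_mult_hom)

lemma conj1_conj1 [simp]: "conj1 (conj1 p) = p"
  by (simp add: map_poly_map_poly o_def)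

abbreviation "positive1 \<equiv> star_functional (\<lambda>c. [:c:]) conj1"

lemma positive1I:
  assumes "\<And>p q. l (p + q) = l p + l q" "\<And>c p. l (smult c p) = c * l p" "\<And>p. l (p * conj1 p) \<in> \<real>\<^sub>\<ge>\<^sub>0"
  shows "positive1 l"
  using assms by unfold_locales (simp_all add: conj1_add conj1_mult map_poly_pCons one_pCons)

abbreviation const2 :: "complex \<Rightarrow> complex poly poly" where "const2 c \<equiv> [:[:c:]:]"

abbreviation "positive2 \<equiv> star_functional const2 conj2"

lemma conj2_add: "conj2 (p + q) = conj2 p + conj2 q"
  by (simp add: conj2_def map_poly_add_hom conj1_add)

lemma conj2_mult: "conj2 (p * q) = conj2 p * conj2 q"
  by (simp add: conj2_def map_poly_mult_hom conj1_add conj1_mult)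

lemma conj2_conj2 [simp]: "conj2 (conj2 p) = p"
  by (induction p) (simp_all add: conj2_def map_poly_pCons)

lemma conj2_x1_poly: "conj2 (x1_poly p) = x1_poly (conj1 p)"
  by (simp add: conj2_def x1_poly_def map_poly_pCons)

lemma conj2_const2 [simp]: "conj2 (const2 c) = const2 (cnj c)"
  by (simp add: conj2_def map_poly_pCons)

lemma positive2I:
  assumes "\<And>p q. l (p + q) = l p + l q" "\<And>c p. l (const2 c * p) = c * l p" "\<And>p. l (p * conj2 p) \<in> \<real>\<^sub>\<ge>\<^sub>0"
  shows "positive2 l"
  using assms by unfold_locales (simp_all add: conj2_add conj2_mult one_pCons)

section \<open>Gauss quadrature\<close>

abbreviation deg_less :: "nat \<Rightarrow> complex poly \<Rightarrow> bool" where
  "deg_less n p \<equiv> (\<forall>i\<ge>n. coeff p i = 0)"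

lemma deg_less_iff: "deg_less n p \<longleftrightarrow> p = 0 \<or> degree p < n"
  by (metis coeff_0 coeff_eq_0 leading_coeff_0_iff linorder_not_le order_less_le_trans)

lemma deg_less_conj1: "deg_less n (conj1 p) \<longleftrightarrow> deg_less n p"
  by (simp add: coeff_map_poly)

text \<open>
One Gram-Schmidt step per degree. If the new orthogonal polynomial has seminorm zero, no coefficient is
needed for it: by Cauchy-Schwarz it is orthogonal to everything.
\<close>

lemma orthogonal_projection_exists:
  assumes "positive1 l"
  shows "\<exists>g. deg_less n g \<and> (\<forall>h. deg_less n h \<longrightarrow> l ((f - g) * h) = 0)"
proof (induction n arbitrary: f)
  case 0
  interpret star_functional "\<lambda>c. [:c:]" conj1 l by fact
  have "h = 0" if "deg_less 0 h" for h using that by (simp add: poly_eq_iff)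
  then have "l ((f - 0) * h) = 0" if "deg_less 0 h" for h using that by (metis mult_zero_right zero)
  then show ?case by (intro exI[of _ 0]) simp
next
  case (Suc n)
  interpret star_functional "\<lambda>c. [:c:]" conj1 l by fact
  from Suc obtain e where e: "deg_less n e" "\<And>h. deg_less n h \<Longrightarrow> l ((monom 1 n - e) * h) = 0" by blast
  define P where "P = monom 1 n - e"
  from Suc obtain g where g: "deg_less n g" "\<And>h. deg_less n h \<Longrightarrow> l ((f - g) * h) = 0" by blast
  have P: "deg_less (Suc n) P" "coeff P n = 1" using e(1) by (auto simp: P_def)
  define c where "c = (if l (P * conj1 P) = 0 then 0 else l ((f - g) * conj1 P) / l (P * conj1 P))"
  have c: "l ((f - g) * conj1 P) = c * l (P * conj1 P)"
  proof (cases "l (P * conj1 P) = 0")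
    case True
    then have "nrm P = 0" by (simp add: nrm_def)
    then show ?thesis using Cauchy_Schwarz[of "f - g" P] True by simp
  qed (simp add: c_def)
  have lin: "l ((f - (g + smult c P)) * h) = l ((f - g) * h) - c * l (P * h)" for h
    using scale[of c "P * h"] by (simp add: algebra_simps diff add)
  have "l ((f - (g + smult c P)) * h) = 0" if h: "deg_less (Suc n) h" for h
  proof -
    define k where "k = h - smult (coeff h n) (conj1 P)"
    have k: "deg_less n k"
    proof (intro allI impI)
      fix i assume "n \<le> i"
      then show "coeff k i = 0" using h P
        by (cases "i = n") (auto simp: k_def coeff_map_poly)
    qed
    have "l ((f - (g + smult c P)) * k) = 0"
      using g(2)[OF k] e(2)[OF k] by (simp add: lin flip: P_def)
    moreover have "l ((f - (g + smult c P)) * conj1 P) = 0"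
      by (simp add: lin c)
    moreover have "T * h = T * k + [:coeff h n:] * (T * conj1 P)" for T
      by (simp add: k_def algebra_simps)
    then have "(f - (g + smult c P)) * h = (f - (g + smult c P)) * k
        + [:coeff h n:] * ((f - (g + smult c P)) * conj1 P)" .
    ultimately show ?thesis by (simp only: add scale) simp
  qed
  moreover have "deg_less (Suc n) (g + smult c P)" using g(1) P(1) by auto
  ultimately show ?case by blast
qed

text \<open>
The node polynomial of the quadrature. When the form is definite below degree $n$ it is the $n$-th
monic orthogonal polynomial; otherwise it is a monic polynomial of minimal degree in the kernel of the form.
Allowing \<open>degree P \<le> n\<close> lets both cases be treated together.
\<close>

definition gauss_poly :: "(complex poly \<Rightarrow> complex) \<Rightarrow> nat \<Rightarrow> complex poly \<Rightarrow> bool" where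
  "gauss_poly l n P \<longleftrightarrow> lead_coeff P = 1 \<and> degree P \<le> n \<and> (\<forall>g. deg_less n g \<longrightarrow> l (P * g) = 0) \<and>
     (\<forall>h. h \<noteq> 0 \<longrightarrow> degree h < degree P \<longrightarrow> l (h * conj1 h) \<noteq> 0)"

lemma gauss_poly_exists:
  assumes "positive1 l"
  shows "\<exists>P. gauss_poly l n P"
proof -
  interpret star_functional "\<lambda>c. [:c:]" conj1 l by fact
  show ?thesis
  proof (cases "\<exists>h. h \<noteq> 0 \<and> degree h < n \<and> l (h * conj1 h) = 0")
    case True
    define d where "d = (LEAST d. \<exists>h. h \<noteq> 0 \<and> degree h = d \<and> l (h * conj1 h) = 0)"
    have "\<exists>h. h \<noteq> 0 \<and> degree h = d \<and> l (h * conj1 h) = 0"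
      unfolding d_def by (rule LeastI_ex) (use True in blast)
    then obtain h where h: "h \<noteq> 0" "degree h = d" "l (h * conj1 h) = 0" by blast
    have d_le: "d \<le> degree k" if "k \<noteq> 0" "l (k * conj1 k) = 0" for k
      unfolding d_def by (rule Least_le) (use that in blast)
    have dn: "d \<le> n" using True d_le by (meson le_trans less_imp_le)
    define P where "P = smult (inverse (lead_coeff h)) h"
    have "lead_coeff P = 1" "degree P = d"
      using h leading_coeff_neq_0[OF h(1)] by (simp_all add: P_def)
    moreover have "l (P * g) = 0" for g
    proof -
      have "nrm h = 0" using h by (simp add: nrm_def)
      then have "l (h * g) = 0" by (rule eq_0_if_nrm_0)
      moreover have "P * g = [:inverse (lead_coeff h):] * (h * g)" by (simp add: P_def)
      ultimately show ?thesis by (simp only: scale) simp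
    qed
    ultimately show ?thesis unfolding gauss_poly_def using dn d_le by (metis linorder_not_le)
  next
    case False
    obtain e where e: "deg_less n e" "\<And>h. deg_less n h \<Longrightarrow> l ((monom 1 n - e) * h) = 0"
      using orthogonal_projection_exists[OF assms] by blast
    have "deg_less (Suc n) (monom 1 n - e)" "coeff (monom 1 n - e) n = 1" using e(1) by auto
    then have "degree (monom 1 n - e) = n" 
      by (metis deg_less_iff le_degree less_Suc_eq_le order_antisym zero_neq_one coeff_0)
    with e False show ?thesis unfolding gauss_poly_def
      by (intro exI[of _ "monom 1 n - e"]) auto
  qed
qed

text \<open>
For a root $z$ write $P=(x-z)R$. Orthogonality of $P$ to $\overline{R}$ reads
$l(xR\overline{R})=z\,l(R\overline{R})$; both values of $l$ are real and the second one is nonzero by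
definiteness.
\<close>

lemma gauss_poly_root_real:
  assumes "positive1 l" "gauss_poly l n P" "poly P z = 0"
  shows "z \<in> \<real>"
proof -
  interpret star_functional "\<lambda>c. [:c:]" conj1 l by fact
  from assms(2) have P0: "P \<noteq> 0" by (auto simp: gauss_poly_def)
  from assms(3) obtain R where R: "P = [:-z, 1:] * R" by (metis dvdE poly_eq_0_iff_dvd)
  with P0 have R0: "R \<noteq> 0" by auto
  then have deg: "degree R < degree P" unfolding R by (subst degree_mult_eq) auto
  then have "deg_less n (conj1 R)"
    using assms(2) unfolding deg_less_conj1 by (auto simp: gauss_poly_def deg_less_iff)
  then have "l (P * conj1 R) = 0" using assms(2) by (simp add: gauss_poly_def)
  moreover have "P * conj1 R = [:0, 1:] * R * conj1 R - [:z:] * (R * conj1 R)"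
    by (simp add: R algebra_simps)
  ultimately have 1: "l ([:0, 1:] * R * conj1 R) = z * l (R * conj1 R)"
    by (simp only: diff scale) simp
  have "conj1 ([:0, 1:] * R * conj1 R) = [:0, 1:] * R * conj1 R"
    by (simp only: conj1_mult conj1_conj1) (simp add: map_poly_pCons algebra_simps)
  then have 2: "l ([:0, 1:] * R * conj1 R) = cnj (l ([:0, 1:] * R * conj1 R))"
    using hermitian by metis
  have 3: "l (R * conj1 R) \<noteq> 0" using assms(2) R0 deg by (simp add: gauss_poly_def)
  have "cnj (l (R * conj1 R)) = l (R * conj1 R)" using pos_Im[of R] by (simp add: complex_eq_iff)
  then have "z = cnj z" using 1 2 3 by (metis complex_cnj_mult mult_cancel_right)
  then show ?thesis by (simp add: complex_is_Real_iff complex_eq_iff)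
qed

text \<open>
A double root $z$, being real, would give $P=(x-z)^2R$ and hence
$0=l(P\overline{R})=l(S\overline{S})$ for $S=(x-z)R$, which has degree below that of $P$.
\<close>

lemma gauss_poly_simple_roots:
  assumes "positive1 l" "gauss_poly l n P"
  shows "card {z. poly P z = 0} = degree P"
proof -
  interpret star_functional "\<lambda>c. [:c:]" conj1 l by fact
  from assms(2) have P0: "P \<noteq> 0" by (auto simp: gauss_poly_def)
  have "order z P \<le> 1" for z
  proof (rule ccontr)
    assume "\<not> order z P \<le> 1"
    then have "[:-z, 1:]^2 dvd P" by (simp add: order_divides P0)
    then obtain R where R: "P = [:-z, 1:]^2 * R" by (metis dvdE)
    with P0 have R0: "R \<noteq> 0" by auto
    have "poly P z = 0" by (simp add: R)
    from gauss_poly_root_real[OF assms this] have z: "cnj z = z"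
      by (simp add: Reals_cnj_iff)
    let ?S = "[:-z, 1:] * R"
    have dP: "degree P = 2 + degree R" unfolding R using R0
      by (subst degree_mult_eq) (auto simp: degree_power_eq)
    have dS: "degree ?S = 1 + degree R" using R0 by (subst degree_mult_eq) auto
    have "deg_less n (conj1 R)"
      using assms(2) dP unfolding deg_less_conj1 by (auto simp: gauss_poly_def deg_less_iff)
    then have "l (P * conj1 R) = 0" using assms(2) by (simp add: gauss_poly_def)
    moreover have "conj1 [:-z, 1:] = [:-z, 1:]" by (simp add: map_poly_pCons z)
    then have "P * conj1 R = ?S * conj1 ?S"
      by (simp only: conj1_mult R power2_eq_square mult_ac)
    ultimately have "l (?S * conj1 ?S) = 0" by simp
    then show False using assms(2) R0 dP dS unfolding gauss_poly_def
      by (metis (no_types) Suc_eq_plus1 add.commute add_2_eq_Suc' lessI mult_eq_0_iff one_neq_zero pCons_eq_0_iff)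
  qed
  then have rs: "rsquarefree P" unfolding rsquarefree_def using P0
    by (metis One_nat_def le_Suc_eq le_zero_eq)
  have fin: "finite {z. poly P z = 0}" using P0 by (rule poly_roots_finite)
  have "P = (\<Prod>z|poly P z = 0. [:-z, 1:])"
    using complex_poly_decompose_rsquarefree[OF rs] assms(2) by (simp add: gauss_poly_def)
  then have "degree P = degree (\<Prod>z|poly P z = 0. [:-z, 1:])" by simp
  also have "\<dots> = (\<Sum>z|poly P z = 0. degree [:-z, 1:])" by (rule degree_prod_sum_eq) auto
  finally show ?thesis by simp
qed

definition lagrange :: "complex set \<Rightarrow> complex \<Rightarrow> complex poly" where
  "lagrange Z z = (\<Prod>w\<in>Z - {z}. smult (inverse (z - w)) [:-w, 1:])"

lemma poly_lagrange:
  assumes "finite Z" "z \<in> Z" "w \<in> Z"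
  shows "poly (lagrange Z z) w = (if w = z then 1 else 0)"
proof -
  have "poly (smult (inverse (z - x)) [:-x, 1:]) z = 1" if "x \<noteq> z" for x
    using that left_inverse[of "z - x"] by (simp add: algebra_simps)
  then show ?thesis using assms by (auto simp: lagrange_def poly_prod simp del: poly_smult intro!: prod.neutral)
qed

lemma degree_lagrange:
  assumes "finite Z" "z \<in> Z"
  shows "degree (lagrange Z z) < card Z"
proof -
  have "degree (lagrange Z z) \<le> (\<Sum>w\<in>Z - {z}. degree (smult (inverse (z - w)) [:-w, 1:]))"
    unfolding lagrange_def using degree_prod_sum_le[of "Z - {z}" "\<lambda>w. smult (inverse (z - w)) [:-w, 1:]"] assms by (simp add: o_def)
  also have "\<dots> \<le> (\<Sum>w\<in>Z - {z}. 1)" by (intro sum_mono) auto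
  also have "\<dots> < card Z" using assms card_gt_0_iff[of Z] by auto
  finally show ?thesis .
qed

lemma lagrange_interpolation:
  assumes "finite Z" "p = 0 \<or> degree p < card Z"
  shows "p = (\<Sum>z\<in>Z. smult (poly p z) (lagrange Z z))"
proof (rule ccontr)
  define r where "r = p - (\<Sum>z\<in>Z. smult (poly p z) (lagrange Z z))"
  assume "\<not> ?thesis"
  then have r0: "r \<noteq> 0" by (simp add: r_def)
  have "deg_less (card Z) p" using assms(2) by (simp add: deg_less_iff)
  moreover have "deg_less (card Z) (lagrange Z z)" if "z \<in> Z" for z
    using degree_lagrange[OF assms(1) that] by (simp add: deg_less_iff)
  ultimately have "deg_less (card Z) r" by (auto simp: r_def coeff_sum intro!: sum.neutral)
  then have deg: "degree r < card Z" using r0 by (simp add: deg_less_iff)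
  have "poly r w = 0" if "w \<in> Z" for w
  proof -
    have "poly (\<Sum>z\<in>Z. smult (poly p z) (lagrange Z z)) w = (\<Sum>z\<in>Z. if w = z then poly p z else 0)"
      unfolding poly_sum by (rule sum.cong) (use that assms(1) in \<open>auto simp: poly_lagrange\<close>)
    then show ?thesis using that assms(1) by (simp add: r_def)
  qed
  then have "card Z \<le> card {z. poly r z = 0}"
    by (intro card_mono poly_roots_finite r0) auto
  also have "\<dots> \<le> degree r" using r0 by (rule card_poly_roots_bound)
  finally show False using deg by simp
qed

text \<open>
Division by the node polynomial reduces $l$ to the interpolation polynomial at the roots. The
formula is exact up to degree $n+\deg P-1$, so it may be applied to the squares of the Lagrange
polynomials, which shows that the weights are nonnegative.
\<close>

theorem gauss_quadrature:
  assumes "positive1 l"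
  shows "\<exists>Z c. finite Z \<and> (\<forall>z\<in>Z. c z \<ge> 0) \<and>
    (\<forall>p. degree p < n \<longrightarrow> l p = (\<Sum>z\<in>Z. complex_of_real (c z) * poly p (complex_of_real z)))"
proof -
  interpret star_functional "\<lambda>c. [:c:]" conj1 l by fact
  obtain P where P: "gauss_poly l n P" using gauss_poly_exists[OF assms] by blast
  have P0: "P \<noteq> 0" using P by (auto simp: gauss_poly_def)
  define Z where "Z = {z. poly P z = 0}"
  have fin: "finite Z" unfolding Z_def using P0 by (rule poly_roots_finite)
  have card: "card Z = degree P" unfolding Z_def by (rule gauss_poly_simple_roots[OF assms P])
  have real: "cnj z = z" if "z \<in> Z" for z
    using gauss_poly_root_real[OF assms P] that by (auto simp: Z_def Reals_cnj_iff)
  define c where "c z = l (lagrange Z z)" for z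
  have exact: "l p = (\<Sum>z\<in>Z. poly p z * c z)" if "p = 0 \<or> degree p < n + degree P" for p
  proof -
    have "deg_less n (p div P)" unfolding deg_less_iff
    proof (rule disjCI)
      assume *: "\<not> degree (p div P) < n"
      show "p div P = 0"
      proof (rule ccontr)
        assume q0: "p div P \<noteq> 0"
        have "degree P + degree (p div P) = degree (p - p mod P)"
          using degree_mult_eq[OF P0 q0] by (simp add: minus_mod_eq_mult_div)
        also have "\<dots> < n + degree P"
        proof (cases "p mod P = 0")
          case False
          then have "degree (p mod P) < degree P" using degree_mod_less[OF P0, of p] by simp
          moreover have "degree p < n + degree P" using that q0 by auto
          ultimately show ?thesis by (intro degree_diff_less) auto
        qed (use that q0 in auto)
        finally show False using * by simp
      qed
    qed
    then have "l (P * (p div P)) = 0" using P by (simp add: gauss_poly_def)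
    moreover have "p = P * (p div P) + p mod P" by simp
    ultimately have "l p = l (p mod P)" by (metis add add_0)
    also have "p mod P = (\<Sum>z\<in>Z. smult (poly (p mod P) z) (lagrange Z z))"
      by (rule lagrange_interpolation[OF fin]) (use degree_mod_less[OF P0, of p] card in auto)
    also have "\<dots> = (\<Sum>z\<in>Z. [:poly p z:] * lagrange Z z)"
    proof (rule sum.cong)
      fix z assume "z \<in> Z"
      have "poly p z = poly (P * (p div P) + p mod P) z" by simp
      then have "poly p z = poly P z * poly (p div P) z + poly (p mod P) z"
        by (simp only: poly_add poly_mult)
      then have "poly p z = poly (p mod P) z" using \<open>z \<in> Z\<close> by (simp add: Z_def)
      then show "smult (poly (p mod P) z) (lagrange Z z) = [:poly p z:] * lagrange Z z" by simp
    qed simp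
    finally show ?thesis by (simp only: sum scale c_def)
  qed
  have c_nonneg: "c z \<in> \<real>\<^sub>\<ge>\<^sub>0" if z: "z \<in> Z" for z
  proof -
    let ?q = "lagrange Z z * conj1 (lagrange Z z)"
    have "degree ?q \<le> degree (lagrange Z z) + degree (lagrange Z z)"
      by (rule order_trans[OF degree_mult_le]) (simp add: degree_map_poly)
    also have "\<dots> < n + degree P"
      using degree_lagrange[OF fin z] card P by (simp add: gauss_poly_def)
    finally have "l ?q = (\<Sum>w\<in>Z. poly ?q w * c w)" by (intro exact) simp
    also have "\<dots> = (\<Sum>w\<in>Z. if z = w then c w else 0)"
      by (rule sum.cong) (use fin z real in \<open>auto simp: poly_lagrange\<close>)
    also have "\<dots> = c z" using fin z by simp
    finally show ?thesis using pos[of "lagrange Z z"] by simp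
  qed
  have inj: "inj_on Re Z" using real by (auto simp: inj_on_def complex_eq_iff)
  have Re: "complex_of_real (Re z) = z" if "z \<in> Z" for z
    using real[OF that] by (simp add: complex_eq_iff)
  show ?thesis
  proof (intro exI conjI allI impI ballI)
    show "finite (Re ` Z)" using fin by simp
    show "0 \<le> Re (c (complex_of_real z))" if "z \<in> Re ` Z" for z
      using that Re c_nonneg by (auto simp: complex_nonneg_Reals_iff)
    fix p :: "complex poly" assume "degree p < n"
    then have "l p = (\<Sum>z\<in>Z. poly p z * c z)" by (intro exact) simp
    also have "\<dots> = (\<Sum>z\<in>Re ` Z. complex_of_real (Re (c (complex_of_real z))) * poly p (complex_of_real z))"
      unfolding sum.reindex[OF inj] o_def
    proof (rule sum.cong)
      fix z assume "z \<in> Z"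
      then have "complex_of_real (Re (c z)) = c z" using c_nonneg[of z]
        by (simp add: complex_nonneg_Reals_iff complex_eq_iff)
      then show "poly p z * c z = complex_of_real (Re (c (complex_of_real (Re z)))) * poly p (complex_of_real (Re z))"
        using Re[OF \<open>z \<in> Z\<close>] by simp
    qed simp
    finally show "l p = (\<Sum>z\<in>Re ` Z. complex_of_real (Re (c (complex_of_real z))) * poly p (complex_of_real z))" .
  qed
qed

section \<open>Schoenberg's space-filling curve\<close>

text \<open>
A continuous function of period 2 that vanishes on $[0,1/3]$ and equals 1 on $[2/3,1]$. Schoenberg's
coordinate functions read off ternary digits by means of it, the even ones for the first
coordinate (\<open>c = 1\<close>) and the odd ones for the second (\<open>c = 3\<close>).
\<close>

definition tent :: "real \<Rightarrow> real" where
  "tent t = max 0 (min 1 (1 / 2 - cos (pi * t)))"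

definition schoenberg :: "real \<Rightarrow> real \<Rightarrow> real" where
  "schoenberg c t = (\<Sum>k. tent (c * 9 ^ k * t) / 2 ^ Suc k)"

lemma tent_bounds: "0 \<le> tent t" "tent t \<le> 1"
  by (simp_all add: tent_def)

lemma summable_half: "summable (\<lambda>k. 1 / 2 ^ Suc k :: real)"
  using sums_summable[OF power_half_series] by (simp add: power_one_over)

lemma suminf_half: "(\<Sum>k. 1 / 2 ^ Suc k :: real) = 1"
  using sums_unique[OF power_half_series] by (simp add: power_one_over)

lemma summable_schoenberg: "summable (\<lambda>k. tent (c * 9 ^ k * t) / 2 ^ Suc k)"
  by (rule summable_comparison_test[OF _ summable_half])
     (auto simp: tent_bounds divide_right_mono intro!: exI[of _ 0])

lemma schoenberg_bounds: "0 \<le> schoenberg c t" "schoenberg c t \<le> 1"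
proof -
  show "0 \<le> schoenberg c t"
    unfolding schoenberg_def by (intro suminf_nonneg summable_schoenberg) (simp add: tent_bounds)
  have "schoenberg c t \<le> (\<Sum>k. 1 / 2 ^ Suc k)"
    unfolding schoenberg_def
    by (intro suminf_le summable_schoenberg summable_half) (simp add: tent_bounds divide_right_mono)
  then show "schoenberg c t \<le> 1" by (simp only: suminf_half)
qed

lemma continuous_on_schoenberg: "continuous_on UNIV (schoenberg c)"
proof (rule uniform_limit_theorem)
  show "uniform_limit UNIV (\<lambda>n t. \<Sum>k<n. tent (c * 9 ^ k * t) / 2 ^ Suc k) (schoenberg c) sequentially"
    unfolding schoenberg_def
    by (rule Weierstrass_m_test[OF _ summable_half]) (simp add: tent_bounds divide_right_mono)
  show "\<forall>\<^sub>F n in sequentially. continuous_on UNIV (\<lambda>t. \<Sum>k<n. tent (c * 9 ^ k * t) / 2 ^ Suc k)"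
    unfolding tent_def by (intro always_eventually allI continuous_intros) auto
qed simp

definition binary_digit :: "real \<Rightarrow> nat \<Rightarrow> int" where
  "binary_digit u k = \<lfloor>2 ^ Suc k * u\<rfloor> mod 2"

lemma binary_digit_01: "binary_digit u k = 0 \<or> binary_digit u k = 1"
  by (auto simp: binary_digit_def)

lemma binary_expansion:
  assumes "0 \<le> u" "u < 1"
  shows "(\<lambda>k. of_int (binary_digit u k) / 2 ^ Suc k) sums u"
proof -
  have fl: "\<lfloor>2 * x\<rfloor> = 2 * \<lfloor>x\<rfloor> + \<lfloor>2 * x\<rfloor> mod 2" for x :: real
  proof -
    have "\<lfloor>2 * x\<rfloor> div 2 = \<lfloor>x\<rfloor>" by linarith
    then show ?thesis by presburger
  qed
  have part: "(\<Sum>k<n. of_int (binary_digit u k) / 2 ^ Suc k) = (of_int \<lfloor>2 ^ n * u\<rfloor> / 2 ^ n :: real)" for n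
  proof (induction n)
    case 0
    have "\<lfloor>u\<rfloor> = 0" using assms by linarith
    then show ?case by simp
  next
    case (Suc n)
    have "of_int \<lfloor>2 ^ Suc n * u\<rfloor> = (2 * of_int \<lfloor>2 ^ n * u\<rfloor> + of_int (binary_digit u n) :: real)"
      using fl[of "2 ^ n * u"] unfolding binary_digit_def
      by (metis (no_types, opaque_lifting) of_int_add of_int_mult of_int_numeral mult.assoc power_Suc)
    then show ?case using Suc by (simp add: field_simps)
  qed
  have "(\<lambda>n. of_int \<lfloor>2 ^ n * u\<rfloor> / 2 ^ n) \<longlonglongrightarrow> u"
  proof (rule LIMSEQ_I)
    fix r :: real assume "r > 0"
    then obtain N where N: "(1/2) ^ N < r" using real_arch_pow_inv[of r "1/2"] by auto
    have "norm (of_int \<lfloor>2 ^ n * u\<rfloor> / 2 ^ n - u) < r" if "n \<ge> N" for n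
    proof -
      have "\<bar>of_int \<lfloor>2 ^ n * u\<rfloor> - 2 ^ n * u\<bar> \<le> 1" by linarith
      moreover have "of_int \<lfloor>2 ^ n * u\<rfloor> / 2 ^ n - u = (of_int \<lfloor>2 ^ n * u\<rfloor> - 2 ^ n * u) / 2 ^ n"
        by (simp add: field_simps)
      ultimately have "\<bar>of_int \<lfloor>2 ^ n * u\<rfloor> / 2 ^ n - u\<bar> \<le> 1 / 2 ^ n"
        by (simp add: abs_divide divide_right_mono)
      also have "\<dots> \<le> (1/2) ^ N" using that by (simp add: power_divide field_simps power_increasing)
      finally show ?thesis using N by simp
    qed
    then show "\<exists>no. \<forall>n\<ge>no. norm (of_int \<lfloor>2 ^ n * u\<rfloor> / 2 ^ n - u) < r" by blast
  qed
  then show ?thesis unfolding sums_def part .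
qed

lemma ternary_series:
  assumes "\<And>k. a k = (0::int) \<or> a k = 1"
  shows "summable (\<lambda>j. 2 * of_int (a j) / 3 ^ Suc j :: real)"
    and "(\<Sum>j. 2 * of_int (a j) / 3 ^ Suc j :: real) \<in> {0..1}"
proof -
  have a: "0 \<le> (of_int (a j) :: real)" "of_int (a j) \<le> (1::real)" for j
    using assms[of j] by auto
  have g: "summable (\<lambda>j. 2 / 3 ^ Suc j :: real)" "(\<Sum>j. 2 / 3 ^ Suc j :: real) = 1"
    using sums_mult[OF geometric_sums[of "1/3 :: real"], of "2/3"]
    by (simp_all add: sums_iff power_one_over)
  show s: "summable (\<lambda>j. 2 * of_int (a j) / 3 ^ Suc j :: real)"
    by (rule summable_comparison_test[OF _ g(1)])
       (use a in \<open>auto intro!: exI[of _ 0] divide_right_mono\<close>)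
  have "0 \<le> (\<Sum>j. 2 * of_int (a j) / 3 ^ Suc j :: real)" using a by (intro suminf_nonneg s) simp
  moreover have "(\<Sum>j. 2 * of_int (a j) / 3 ^ Suc j :: real) \<le> (\<Sum>j. 2 / 3 ^ Suc j)"
    by (intro suminf_le s g(1)) (use a in \<open>auto intro!: divide_right_mono\<close>)
  ultimately show "(\<Sum>j. 2 * of_int (a j) / 3 ^ Suc j :: real) \<in> {0..1}" using g(2) by simp
qed

text \<open>
Multiplication by $3^k$ turns the leading digits into an even integer, which the period absorbs,
and leaves $2a_k/3$ plus a remainder in $[0,1/3]$; on both resulting intervals the function is
constant.
\<close>

lemma tent_ternary:
  assumes a: "\<And>k. a k = (0::int) \<or> a k = 1"
  shows "tent (3 ^ k * (\<Sum>j. 2 * of_int (a j) / 3 ^ Suc j)) = of_int (a k)"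
proof -
  let ?f = "\<lambda>j. 2 * of_int (a j) / 3 ^ Suc j :: real"
  define r where "r = (\<Sum>j. 2 * of_int (a (j + Suc k)) / 3 ^ Suc j :: real)"
  have r: "r \<in> {0..1}" unfolding r_def by (rule ternary_series) (rule a)
  have "(\<Sum>j. ?f (j + Suc k)) = (\<Sum>j. (2 * of_int (a (j + Suc k)) / 3 ^ Suc j) * (1 / 3 ^ Suc k))"
    by (rule suminf_cong) (simp add: power_add)
  also have "\<dots> = r * (1 / 3 ^ Suc k)" unfolding r_def
    by (rule suminf_mult2[symmetric]) (rule ternary_series, rule a)
  finally have tail: "(\<Sum>j. ?f (j + Suc k)) = r / 3 ^ Suc k" by simp
  define m where "m = (\<Sum>j<k. a j * 3 ^ (k - Suc j))"
  have head: "3 ^ k * (\<Sum>j<k. ?f j) = of_int (2 * m)"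
  proof -
    have "3 ^ k * ?f j = of_int (2 * (a j * 3 ^ (k - Suc j)))" if "j < k" for j
    proof -
      have "(3::real) ^ k = 3 ^ (k - Suc j) * 3 ^ Suc j"
        using that by (simp flip: power_add del: power_Suc)
      then show ?thesis by simp
    qed
    then show ?thesis unfolding m_def sum_distrib_left of_int_sum by (intro sum.cong) auto
  qed
  have "suminf ?f = (\<Sum>j. ?f (j + Suc k)) + sum ?f {..<Suc k}"
    by (rule suminf_split_initial_segment) (rule ternary_series, rule a)
  then have "3 ^ k * suminf ?f = of_int (2 * m) + (2 * of_int (a k) + r) / 3"
    using head unfolding tail by (simp add: distrib_left add_divide_distrib)
  then have "pi * (3 ^ k * suminf ?f) = pi * ((2 * of_int (a k) + r) / 3) + (2 * pi) * of_int m"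
    by (simp add: algebra_simps)
  then have "cos (pi * (3 ^ k * suminf ?f)) = cos (pi * ((2 * of_int (a k) + r) / 3) + (2 * pi) * of_int m)"
    by (rule arg_cong)
  also have "\<dots> = cos (pi * ((2 * of_int (a k) + r) / 3))"
    by (subst cos_add, subst cos_int_2pin, subst sin_int_2pin) simp
  finally have cos: "cos (pi * (3 ^ k * suminf ?f)) = cos (pi * ((2 * of_int (a k) + r) / 3))" .
  show ?thesis
  proof (cases "a k = 0")
    case True
    have "cos (pi / 3) \<le> cos (pi * (r / 3))" by (rule cos_monotone_0_pi_le) (use r in auto)
    then show ?thesis using True cos by (simp add: tent_def cos_60)
  next
    case False
    then have ak: "a k = 1" using a by auto
    have "cos (pi * ((2 + r) / 3)) \<le> cos (2 * pi / 3)" by (rule cos_monotone_0_pi_le) (use r in auto)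
    moreover have "cos (2 * pi / 3) = - 1 / 2" using cos_120 by (simp add: mult.commute)
    ultimately show ?thesis using ak cos by (simp add: tent_def)
  qed
qed

theorem schoenberg_onto:
  assumes "0 \<le> u" "u < 1" "0 \<le> v" "v < 1"
  shows "\<exists>t\<in>{0..1}. schoenberg 1 t = u \<and> schoenberg 3 t = v"
proof -
  define a where "a k = (if even k then binary_digit u (k div 2) else binary_digit v (k div 2))" for k :: nat
  have a: "a k = 0 \<or> a k = 1" for k using binary_digit_01 by (simp add: a_def)
  define t where "t = (\<Sum>j. 2 * of_int (a j) / 3 ^ Suc j :: real)"
  have "t \<in> {0..1}" unfolding t_def by (rule ternary_series) (rule a)
  moreover have "schoenberg 1 t = u"
  proof -
    have "tent (1 * 9 ^ k * t) = of_int (binary_digit u k)" for k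
      using tent_ternary[OF a, of "2 * k"] by (simp add: a_def t_def power_mult)
    then show ?thesis unfolding schoenberg_def using binary_expansion[of u] assms by (simp only: sums_iff)
  qed
  moreover have "schoenberg 3 t = v"
  proof -
    have "tent (3 * 9 ^ k * t) = of_int (binary_digit v k)" for k
      using tent_ternary[OF a, of "Suc (2 * k)"] by (simp add: a_def t_def power_mult)
    then show ?thesis unfolding schoenberg_def using binary_expansion[of v] assms by (simp only: sums_iff)
  qed
  ultimately show ?thesis by blast
qed

section \<open>Limits of atomic measures\<close>

text \<open>
The line is identified with the open unit interval, so that the plane becomes the open unit square, on which the
curve can be inverted.
\<close>

definition unit_code :: "real \<Rightarrow> real" where
  "unit_code x = arctan x / pi + 1 / 2"

definition unit_decode :: "real \<Rightarrow> real" where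
  "unit_decode u = tan (pi * (u - 1 / 2))"

text \<open>
Decoding followed by truncation to $[-k,k]$. Unlike decoding itself this is continuous and
bounded on the whole line, so it may be used as a test function for weak convergence; on the boundary
of the unit interval it has modulus $k$.
\<close>

definition clamped_decode :: "real \<Rightarrow> real \<Rightarrow> real" where
  "clamped_decode k u = tan (max (- arctan k) (min (arctan k) (pi * (u - 1 / 2))))"

lemma unit_code_bounds: "0 < unit_code x" "unit_code x < 1"
  using arctan_bounded[of x] by (simp_all add: unit_code_def field_simps)

lemma unit_code_decode:
  assumes "0 < u" "u < 1"
  shows "unit_code (unit_decode u) = u"
proof -
  have "- (pi / 2) < pi * (u - 1 / 2)" "pi * (u - 1 / 2) < pi / 2"
    using assms pi_gt_zero by (simp_all add: algebra_simps)
  then show ?thesis by (simp add: unit_code_def unit_decode_def arctan_tan)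
qed

lemma clamped_decode_code: "clamped_decode k (unit_code x) = max (- k) (min k x)"
proof -
  have "pi * (unit_code x - 1 / 2) = arctan x" by (simp add: unit_code_def)
  moreover have "max (- arctan k) (min (arctan k) (arctan x)) = arctan (max (- k) (min k x))"
    using monoI[of arctan, OF arctan_monotone'] by (simp add: min_of_mono max_of_mono flip: arctan_minus)
  ultimately show ?thesis by (simp add: clamped_decode_def tan_arctan)
qed

lemma clamped_decode_eq:
  assumes "0 < u" "u < 1"
  shows "clamped_decode k u = max (- k) (min k (unit_decode u))"
  using clamped_decode_code[of k "unit_decode u"] by (simp add: unit_code_decode assms)

lemma clamped_range:
  assumes "k > 0"
  shows "max (- arctan k) (min (arctan k) \<theta>) \<in> {- arctan k..arctan k}"
    "- (pi / 2) < max (- arctan k) (min (arctan k) \<theta>)"  "max (- arctan k) (min (arctan k) \<theta>) < pi / 2"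
proof -
  have "arctan k > 0" using assms by simp
  then show "max (- arctan k) (min (arctan k) \<theta>) \<in> {- arctan k..arctan k}"
    "- (pi / 2) < max (- arctan k) (min (arctan k) \<theta>)" "max (- arctan k) (min (arctan k) \<theta>) < pi / 2"
    using arctan_bounded[of k] by (auto simp: max_def min_def)
qed

lemma abs_clamped_decode_le:
  assumes "k > 0"
  shows "\<bar>clamped_decode k u\<bar> \<le> k"
proof -
  define \<theta> where "\<theta> = max (- arctan k) (min (arctan k) (pi * (u - 1 / 2)))"
  have \<theta>: "- arctan k \<le> \<theta>" "\<theta> \<le> arctan k" "- (pi / 2) < \<theta>" "\<theta> < pi / 2"
    using clamped_range[OF assms, of "pi * (u - 1 / 2)"] by (auto simp: \<theta>_def)
  have "tan \<theta> \<le> tan (arctan k)" using tan_mono_le[of \<theta> "arctan k"] \<theta> arctan_bounded[of k] by simp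
  moreover have "tan (- arctan k) \<le> tan \<theta>" using tan_mono_le[of "- arctan k" \<theta>] \<theta> arctan_bounded[of k] by simp
  ultimately show ?thesis by (simp add: clamped_decode_def tan_arctan flip: \<theta>_def)
qed

lemma abs_clamped_decode_boundary:
  assumes "k > 0" "u = 0 \<or> u = 1"
  shows "\<bar>clamped_decode k u\<bar> = k"
proof -
  have *: "arctan k > 0" "arctan k < pi / 2" "\<not> arctan k \<le> - (pi / 2)"
    using assms arctan_bounded[of k] by auto
  have "max (- arctan k) (min (arctan k) (- pi / 2)) = - arctan k"
    "max (- arctan k) (min (arctan k) (pi / 2)) = arctan k" using * by (simp_all add: min_def max_def)
  then show ?thesis using assms by (auto simp: clamped_decode_def tan_arctan)
qed

lemma continuous_on_clamped_decode:
  assumes "k > 0"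
  shows "continuous_on UNIV (clamped_decode k)"
proof -
  have "cos (max (- arctan k) (min (arctan k) (pi * (u - 1 / 2)))) \<noteq> 0" for u
    using clamped_range[OF assms, of "pi * (u - 1 / 2)"] cos_gt_zero_pi by (metis less_irrefl)
  then show ?thesis unfolding clamped_decode_def by (intro continuous_intros) auto
qed

text \<open>
The difference vanishes where both coordinates are at most $k$ in modulus, and elsewhere
$(x^2+y^2)/k^2\ge 1$. Thus truncation costs $O(k^{-2})$ times a moment, uniformly over measures with bounded
moments.
\<close>

lemma clamp_error:
  fixes x y k :: real
  assumes "k > 0"
  defines "c \<equiv> \<lambda>x. max (- k) (min k x)"
  shows "\<bar>c x ^ m * c y ^ n - x ^ m * y ^ n\<bar> \<le> (x\<^sup>2 + y\<^sup>2) * (1 + x ^ (2 * m) * y ^ (2 * n)) / k\<^sup>2"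
proof (cases "\<bar>x\<bar> \<le> k \<and> \<bar>y\<bar> \<le> k")
  case True
  then have "c x = x" "c y = y" by (auto simp: c_def)
  then show ?thesis by (simp add: power_mult)
next
  case False
  have abs: "\<bar>c x\<bar> \<le> \<bar>x\<bar>" for x using assms by (auto simp: c_def)
  define a where "a = x ^ m * y ^ n"
  have "\<bar>c x ^ m * c y ^ n\<bar> \<le> \<bar>a\<bar>"
    unfolding a_def abs_mult power_abs by (intro mult_mono power_mono abs) auto
  then have "\<bar>c x ^ m * c y ^ n - a\<bar> \<le> 2 * \<bar>a\<bar>" by linarith
  also have "\<dots> \<le> 1 + a\<^sup>2" using sum_squares_bound[of 1 "\<bar>a\<bar>"] by simp
  also have "1 + a\<^sup>2 \<le> (1 + a\<^sup>2) * ((x\<^sup>2 + y\<^sup>2) / k\<^sup>2)"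
  proof -
    have "k\<^sup>2 \<le> x\<^sup>2 + y\<^sup>2"
    proof (cases "\<bar>x\<bar> \<le> k")
      case True
      then have "k\<^sup>2 \<le> \<bar>y\<bar>\<^sup>2" using False assms by (intro power_mono) auto
      then show ?thesis using zero_le_power2[of x] unfolding power2_abs by linarith
    next
      case F: False
      then have "k\<^sup>2 \<le> \<bar>x\<bar>\<^sup>2" using assms by (intro power_mono) auto
      then show ?thesis using zero_le_power2[of y] unfolding power2_abs by linarith
    qed
    then have "1 \<le> (x\<^sup>2 + y\<^sup>2) / k\<^sup>2" using assms by simp
    moreover have "0 \<le> 1 + a\<^sup>2" by (simp add: add_nonneg_nonneg)
    ultimately show ?thesis using mult_left_mono[of 1 "(x\<^sup>2 + y\<^sup>2) / k\<^sup>2" "1 + a\<^sup>2"] by simp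
  qed
  finally show ?thesis by (simp add: a_def power_mult_distrib power_mult mult.commute flip: power_mult)
qed

lemma measurable_monomial: "(\<lambda>z :: real \<times> real. fst z ^ m * snd z ^ n) \<in> borel_measurable borel"
  by (intro borel_measurable_continuous_onI continuous_intros)

text \<open>
The atoms are lifted to $[0,1]$ along the space-filling curve and a weak limit of the lifted
measures is pushed forward again. Two points need care: the limit might charge the boundary
of the square, which is the infinity of the plane, and monomials are unbounded. Both are settled by
the truncated monomials \<open>F k m n\<close> and the bounds on their integrals that come from the convergent moments.
\<close>

theorem limit_of_atomic_probabilities:
  fixes p :: "nat \<Rightarrow> real \<times> real \<Rightarrow> real" and s :: "nat \<Rightarrow> nat \<Rightarrow> real"
  assumes fin: "\<And>N. finite (A N)"
    and nonneg: "\<And>N z. z \<in> A N \<Longrightarrow> 0 \<le> p N z"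
    and total: "\<And>N. (\<Sum>z\<in>A N. p N z) = 1"
    and lim: "\<And>m n. (\<lambda>N. \<Sum>z\<in>A N. p N z * (fst z ^ m * snd z ^ n)) \<longlonglongrightarrow> s m n"
  shows "\<exists>\<mu>. sets \<mu> = sets borel \<and>
    (\<forall>m n. integrable \<mu> (\<lambda>z. fst z ^ m * snd z ^ n) \<and> (LINT z|\<mu>. fst z ^ m * snd z ^ n) = s m n)"
proof -
  define S where "S N m n = (\<Sum>z\<in>A N. p N z * (fst z ^ m * snd z ^ n))" for N m n
  have "\<exists>t\<in>{0..1}. schoenberg 1 t = unit_code (fst z) \<and> schoenberg 3 t = unit_code (snd z)" for z :: "real \<times> real"
    by (intro schoenberg_onto) (simp_all add: unit_code_bounds less_imp_le)
  then obtain c where c: "\<And>z. c z \<in> {0..1::real}" "\<And>z. schoenberg 1 (c z) = unit_code (fst z)"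
      "\<And>z. schoenberg 3 (c z) = unit_code (snd z)" by metis
  define \<nu> where "\<nu> N = distr (point_measure (A N) (\<lambda>z. ennreal (p N z))) borel c" for N
  have meas_c: "c \<in> point_measure (A N) (\<lambda>z. ennreal (p N z)) \<rightarrow>\<^sub>M borel" for N
    by (simp add: measurable_point_measure_eq1)
  have integral_\<nu>: "(LINT t|\<nu> N. f t) = (\<Sum>z\<in>A N. p N z * f (c z))"
    if "f \<in> borel_measurable borel" for N and f :: "real \<Rightarrow> real"
    unfolding \<nu>_def by (subst integral_distr[OF meas_c that], subst lebesgue_integral_point_measure_finite)
      (auto simp: fin nonneg)
  have em: "emeasure (\<nu> N) {0..1} = 1" "emeasure (\<nu> N) UNIV = 1" for N
  proof -
    have *: "emeasure (point_measure (A N) (\<lambda>z. ennreal (p N z))) (A N) = 1"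
      using fin[of N] nonneg[of _ N] total[of N]
      by (simp add: emeasure_point_measure_finite sum_ennreal flip: ennreal_1)
    have "c -` {0..1} \<inter> A N = A N" using c(1) by auto
    then show "emeasure (\<nu> N) {0..1} = 1" "emeasure (\<nu> N) UNIV = 1"
      using * unfolding \<nu>_def by (simp_all add: emeasure_distr[OF meas_c] space_point_measure)
  qed
  have real_\<nu>: "real_distribution (\<nu> N)" for N
  proof -
    have "prob_space (\<nu> N)" by (rule prob_spaceI) (use em(2) in \<open>simp add: \<nu>_def\<close>)
    then show ?thesis by (simp add: real_distribution_def real_distribution_axioms_def \<nu>_def)
  qed
  have tight: "tight \<nu>"
    unfolding tight_def
  proof (intro conjI allI impI real_\<nu>)
    fix e :: real assume "e > 0"
    have "measure (\<nu> N) {-1<..1} > 1 - e" for N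
    proof -
      interpret real_distribution "\<nu> N" by (rule real_\<nu>)
      have "measure (\<nu> N) {0..1} \<le> measure (\<nu> N) {-1<..1}" by (rule finite_measure_mono) auto
      moreover have "measure (\<nu> N) {0..1} = 1" using em(1)[of N] by (simp add: measure_def)
      ultimately show ?thesis using \<open>e > 0\<close> by linarith
    qed
    then show "\<exists>a b. a < b \<and> (\<forall>n. 1 - e < measure (\<nu> n) {a<..b})" by (intro exI[of _ "-1"] exI[of _ 1]) auto
  qed
  obtain r M where r: "strict_mono r" and M: "real_distribution M" and conv: "weak_conv_m (\<nu> \<circ> id \<circ> r) M"
    using tight_imp_convergent_subsubsequence[OF tight strict_mono_id] by auto
  interpret M: real_distribution M by (rule M)
  define X where "X = schoenberg 1"
  define Y where "Y = schoenberg 3"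
  have [measurable]: "X \<in> borel_measurable borel" "Y \<in> borel_measurable borel"
    by (simp_all add: X_def Y_def borel_measurable_continuous_onI continuous_on_schoenberg)
  have XY_bounds: "0 \<le> X t" "X t \<le> 1" "0 \<le> Y t" "Y t \<le> 1" for t
    by (simp_all add: X_def Y_def schoenberg_bounds)
  define F where "F k m n t = clamped_decode k (X t) ^ m * clamped_decode k (Y t) ^ n" for k m n t
  have contF: "continuous_on UNIV (F k m n)" if "k > 0" for k m n
  proof -
    have "continuous_on UNIV (\<lambda>t. clamped_decode k (X t))" "continuous_on UNIV (\<lambda>t. clamped_decode k (Y t))"
      unfolding X_def Y_def
      by (rule continuous_on_compose2[OF continuous_on_clamped_decode[OF that] continuous_on_schoenberg]; simp)+
    then show ?thesis unfolding F_def by (intro continuous_intros)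
  qed
  have absF: "\<bar>F k m n t\<bar> \<le> k ^ m * k ^ n" if "k > 0" for k m n t
    unfolding F_def abs_mult power_abs using that
    by (intro mult_mono power_mono abs_clamped_decode_le) auto
  have measF: "F k m n \<in> borel_measurable borel" if "k > 0" for k m n
    using contF[OF that] by (rule borel_measurable_continuous_onI)
  have intF: "integrable M (F k m n)" if "k > 0" for k m n
    by (rule M.integrable_const_bound[of _ "k ^ m * k ^ n"]) (use absF measF that in auto)
  have integral_F_\<nu>: "(LINT t|\<nu> N. F k m n t) =
      (\<Sum>z\<in>A N. p N z * (max (- k) (min k (fst z)) ^ m * max (- k) (min k (snd z)) ^ n))" if "k > 0" for k m n N
    by (simp add: integral_\<nu> measF that) (simp add: F_def X_def Y_def c clamped_decode_code)
  have limF: "(\<lambda>N. LINT t|\<nu> (r N). F k m n t) \<longlonglongrightarrow> (LINT t|M. F k m n t)" if "k > 0" for k m n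
    using weak_conv_imp_integral_bdd_continuous_conv[of "\<nu> \<circ> id \<circ> r" M "F k m n" "k ^ m * k ^ n"]
      real_\<nu> M conv contF[OF that] absF[OF that]
    by (simp add: continuous_on_eq_continuous_at o_def)
  have limS: "(\<lambda>N. S (r N) m n) \<longlonglongrightarrow> s m n" for m n
    using LIMSEQ_subseq_LIMSEQ[OF lim r, of m n] by (simp add: S_def o_def)
  have F_even: "(LINT t|M. F k (2 * m) (2 * n) t) \<le> s (2 * m) (2 * n)" if "k > 0" for k m n
  proof (rule LIMSEQ_le[OF limF[OF that] limS])
    have abs: "max (- k) (min k x) ^ (2 * m) \<le> x ^ (2 * m)" for x m
    proof -
      have "\<bar>max (- k) (min k x)\<bar> \<le> \<bar>x\<bar>" using that by (auto simp: max_def min_def)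
      then have "(max (- k) (min k x))\<^sup>2 \<le> x\<^sup>2" by (simp add: abs_le_square_iff)
      from power_mono[OF this, of m] show ?thesis by (simp add: power_mult)
    qed
    have "(LINT t|\<nu> N. F k (2 * m) (2 * n) t) \<le> S N (2 * m) (2 * n)" for N
      unfolding integral_F_\<nu>[OF that] S_def
      by (intro sum_mono mult_left_mono mult_mono abs nonneg) (auto simp: power_mult)
    then show "\<exists>N. \<forall>n'\<ge>N. (LINT t|\<nu> (r n'). F k (2 * m) (2 * n) t) \<le> S (r n') (2 * m) (2 * n)" by blast
  qed
  \<comment> \<open>On the boundary the truncated coordinate squared is k squared, while its integral stays bounded as k grows.\<close>
  have null: "measure M {t. W t = 0 \<or> W t = 1} = 0"
    if W: "W \<in> borel_measurable borel" and le: "\<And>k. k > 0 \<Longrightarrow> (LINT t|M. (clamped_decode k (W t))\<^sup>2) \<le> C"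
      and int: "\<And>k. k > 0 \<Longrightarrow> integrable M (\<lambda>t. (clamped_decode k (W t))\<^sup>2)" for W C
  proof -
    let ?B = "{t. W t = 0 \<or> W t = 1}"
    have B: "?B \<in> sets M" using W by simp
    have "k * measure M ?B \<le> C" if "k \<ge> 1" for k :: real
    proof -
      have "k * measure M ?B \<le> k\<^sup>2 * measure M ?B" using that by (intro mult_right_mono) (auto simp: power2_eq_square)
      also have "\<dots> = (LINT t|M. k\<^sup>2 * indicator ?B t)" using B by simp
      also have "\<dots> \<le> (LINT t|M. (clamped_decode k (W t))\<^sup>2)"
      proof (rule integral_mono)
        show "k\<^sup>2 * indicator ?B t \<le> (clamped_decode k (W t))\<^sup>2" for t
        proof (cases "t \<in> ?B")
          case True
          then have "\<bar>clamped_decode k (W t)\<bar> = k" using that by (intro abs_clamped_decode_boundary) auto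
          then have "(clamped_decode k (W t))\<^sup>2 = k\<^sup>2" by (metis power2_abs)
          then show ?thesis using True by simp
        qed simp
        have "integrable M (indicator ?B :: real \<Rightarrow> real)"
          by (rule integrable_real_indicator[OF B]) (simp add: M.emeasure_eq_measure)
        then show "integrable M (\<lambda>t. k\<^sup>2 * indicator ?B t)" by simp
      qed (use that int in auto)
      also have "\<dots> \<le> C" using that by (intro le) auto
      finally show ?thesis .
    qed
    note key = this
    show ?thesis
    proof (rule ccontr)
      assume "measure M ?B \<noteq> 0"
      then have pos: "measure M ?B > 0" using measure_nonneg[of M ?B] by linarith
      define k where "k = max 1 ((\<bar>C\<bar> + 1) / measure M ?B)"
      have "(\<bar>C\<bar> + 1) / measure M ?B * measure M ?B \<le> k * measure M ?B"
        by (rule mult_right_mono) (auto simp: k_def)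
      also have "\<dots> \<le> C" by (rule key) (simp add: k_def)
      finally show False using pos by simp
    qed
  qed
  have "measure M {t. X t = 0 \<or> X t = 1} = 0"
    by (rule null[of X "s 2 0"])
      (use F_even[of _ 1 0] intF[of _ 2 0] in \<open>auto simp: F_def[abs_def]\<close>)
  moreover have "measure M {t. Y t = 0 \<or> Y t = 1} = 0"
    by (rule null[of Y "s 0 2"])
      (use F_even[of _ 0 1] intF[of _ 0 2] in \<open>auto simp: F_def[abs_def]\<close>)
  ultimately have "emeasure M {t. X t = 0 \<or> X t = 1} = 0" "emeasure M {t. Y t = 0 \<or> Y t = 1} = 0"
    by (simp_all add: M.emeasure_eq_measure)
  then have "AE t in M. \<not> (X t = 0 \<or> X t = 1)" "AE t in M. \<not> (Y t = 0 \<or> Y t = 1)"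
    by (intro AE_I[where N = "{t. X t = 0 \<or> X t = 1}"] AE_I[where N = "{t. Y t = 0 \<or> Y t = 1}"]; simp)+
  then have ae: "AE t in M. 0 < X t \<and> X t < 1 \<and> 0 < Y t \<and> Y t < 1"
  proof eventually_elim
    case (elim t)
    then show ?case using XY_bounds[of t] by auto
  qed
  define x where "x t = unit_decode (X t)" for t
  define y where "y t = unit_decode (Y t)" for t
  have [measurable]: "x \<in> borel_measurable borel" "y \<in> borel_measurable borel"
    unfolding x_def y_def unit_decode_def tan_def by measurable
  have ae_clamp: "AE t in M. \<forall>k m n. F k m n t = max (- k) (min k (x t)) ^ m * max (- k) (min k (y t)) ^ n"
    using ae by eventually_elim (simp add: F_def x_def y_def clamped_decode_eq)
  have lim_clamp: "(\<lambda>k. max (- real (Suc k)) (min (real (Suc k)) x) ^ m * max (- real (Suc k)) (min (real (Suc k)) y) ^ n)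
     \<longlonglongrightarrow> x ^ m * y ^ n" for x y :: real and m n
  proof (rule tendsto_eventually)
    obtain K where K: "\<bar>x\<bar> + \<bar>y\<bar> \<le> real K" using real_arch_simple by blast
    have "max (- real (Suc k)) (min (real (Suc k)) x) ^ m * max (- real (Suc k)) (min (real (Suc k)) y) ^ n = x ^ m * y ^ n"
      if "k \<ge> K" for k
    proof -
      have "\<bar>x\<bar> + \<bar>y\<bar> \<le> real (Suc k)" using K that by linarith
      then have "max (- real (Suc k)) (min (real (Suc k)) x) = x" "max (- real (Suc k)) (min (real (Suc k)) y) = y"
        by linarith+
      then show ?thesis by simp
    qed
    then show "\<forall>\<^sub>F k in sequentially. max (- real (Suc k)) (min (real (Suc k)) x) ^ m *
        max (- real (Suc k)) (min (real (Suc k)) y) ^ n = x ^ m * y ^ n"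
      unfolding eventually_sequentially by blast
  qed
  have ae_lim: "AE t in M. (\<lambda>k. F (real (Suc k)) m n t) \<longlonglongrightarrow> x t ^ m * y t ^ n" for m n
    using ae_clamp by eventually_elim (use lim_clamp in simp)
  \<comment> \<open>Fatou bounds the even moments, and the even moments dominate all others.\<close>
  have int_even: "integrable M (\<lambda>t. x t ^ (2 * m) * y t ^ (2 * n))" for m n
  proof (rule integrableI_bounded)
    let ?g = "\<lambda>t. x t ^ (2 * m) * y t ^ (2 * n)"
    show "?g \<in> borel_measurable M" by measurable
    have "(\<integral>\<^sup>+ t. ennreal (norm (?g t)) \<partial>M) \<le>
        (\<integral>\<^sup>+ t. liminf (\<lambda>k. ennreal (F (real (Suc k)) (2 * m) (2 * n) t)) \<partial>M)"
    proof (rule nn_integral_mono_AE)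
      show "AE t in M. ennreal (norm (?g t)) \<le> liminf (\<lambda>k. ennreal (F (real (Suc k)) (2 * m) (2 * n) t))"
        using ae_lim[of "2 * m" "2 * n"]
      proof eventually_elim
        case (elim t)
        have "norm (?g t) = ?g t" by (simp add: power_mult)
        then have "(\<lambda>k. ennreal (F (real (Suc k)) (2 * m) (2 * n) t)) \<longlonglongrightarrow> ennreal (norm (?g t))"
          using tendsto_ennrealI[OF elim] by simp
        then show ?case by (simp add: lim_imp_Liminf)
      qed
    qed
    also have "\<dots> \<le> liminf (\<lambda>k. \<integral>\<^sup>+ t. ennreal (F (real (Suc k)) (2 * m) (2 * n) t) \<partial>M)"
      by (rule nn_integral_liminf) (use measF in simp)
    also have "\<dots> \<le> ennreal (s (2 * m) (2 * n))"
    proof (rule Liminf_le)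
      have "(\<integral>\<^sup>+ t. ennreal (F (real (Suc k)) (2 * m) (2 * n) t) \<partial>M) \<le> ennreal (s (2 * m) (2 * n))" for k
      proof -
        have "(\<integral>\<^sup>+ t. ennreal (F (real (Suc k)) (2 * m) (2 * n) t) \<partial>M) = ennreal (LINT t|M. F (real (Suc k)) (2 * m) (2 * n) t)"
          by (rule nn_integral_eq_integral[OF intF]) (auto simp: F_def power_mult)
        also have "\<dots> \<le> ennreal (s (2 * m) (2 * n))" by (intro ennreal_leI F_even) simp
        finally show ?thesis .
      qed
      then show "\<forall>\<^sub>F k in sequentially. (\<integral>\<^sup>+ t. ennreal (F (real (Suc k)) (2 * m) (2 * n) t) \<partial>M) \<le> ennreal (s (2 * m) (2 * n))"
        by simp
    qed simp
    finally show "(\<integral>\<^sup>+ t. ennreal (norm (?g t)) \<partial>M) < \<infinity>"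
      by (rule order_le_less_trans) simp
  qed
  have int: "integrable M (\<lambda>t. x t ^ m * y t ^ n)" for m n
  proof (rule Bochner_Integration.integrable_bound)
    show "integrable M (\<lambda>t. 1 + x t ^ (2 * m) * y t ^ (2 * n))"
      by (intro Bochner_Integration.integrable_add int_even) simp
    have abs_le: "\<bar>a\<bar> \<le> 1 + a\<^sup>2" for a :: real
      using sum_squares_bound[of 1 "\<bar>a\<bar>"] by simp
    have "\<bar>x t ^ m * y t ^ n\<bar> \<le> 1 + x t ^ (2 * m) * y t ^ (2 * n)" for t
      using abs_le[of "x t ^ m * y t ^ n"]
      by (simp only: power_mult_distrib mult.commute[of 2] power_mult)
    then show "AE t in M. norm (x t ^ m * y t ^ n) \<le> norm (1 + x t ^ (2 * m) * y t ^ (2 * n))"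
      unfolding real_norm_def by (intro always_eventually allI order_trans[OF _ abs_ge_self])
  qed simp
  have lim1: "(\<lambda>k. LINT t|M. F (real (Suc k)) m n t) \<longlonglongrightarrow> (LINT t|M. x t ^ m * y t ^ n)" for m n
  proof (rule integral_dominated_convergence)
    show "integrable M (\<lambda>t. \<bar>x t ^ m * y t ^ n\<bar>)" using int by (rule integrable_abs)
    show "AE t in M. norm (F (real (Suc k)) m n t) \<le> \<bar>x t ^ m * y t ^ n\<bar>" for k
      using ae_clamp
    proof eventually_elim
      case (elim t)
      have "\<bar>max (- real (Suc k)) (min (real (Suc k)) u)\<bar> \<le> \<bar>u\<bar>" for u by (auto simp: max_def min_def)
      then show ?case unfolding elim[rule_format] real_norm_def abs_mult power_abs
        by (intro mult_mono power_mono) auto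
    qed
  qed (use ae_lim measF in simp_all)
  have lim2: "(\<lambda>k. LINT t|M. F (real (Suc k)) m n t) \<longlonglongrightarrow> s m n" for m n
  proof -
    define E where "E N = S N 2 0 + S N 0 2 + S N (2 * m + 2) (2 * n) + S N (2 * m) (2 * n + 2)" for N
    define D where "D = s 2 0 + s 0 2 + s (2 * m + 2) (2 * n) + s (2 * m) (2 * n + 2)"
    have limE: "(\<lambda>N. E (r N)) \<longlonglongrightarrow> D" unfolding E_def D_def by (intro tendsto_add limS)
    have err: "\<bar>(LINT t|\<nu> N. F k m n t) - S N m n\<bar> \<le> E N / k\<^sup>2" if "k > 0" for k N
    proof -
      have "\<bar>(LINT t|\<nu> N. F k m n t) - S N m n\<bar> \<le>
        (\<Sum>z\<in>A N. p N z * (((fst z)\<^sup>2 + (snd z)\<^sup>2) * (1 + fst z ^ (2 * m) * snd z ^ (2 * n)) / k\<^sup>2))"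
        unfolding integral_F_\<nu>[OF that] S_def sum_subtractf[symmetric] right_diff_distrib[symmetric]
      proof (rule order_trans[OF sum_abs], rule sum_mono)
        fix z assume z: "z \<in> A N"
        show "\<bar>p N z * (max (- k) (min k (fst z)) ^ m * max (- k) (min k (snd z)) ^ n - fst z ^ m * snd z ^ n)\<bar>
          \<le> p N z * (((fst z)\<^sup>2 + (snd z)\<^sup>2) * (1 + fst z ^ (2 * m) * snd z ^ (2 * n)) / k\<^sup>2)"
          unfolding abs_mult[of "p N z"] abs_of_nonneg[OF nonneg[OF z]]
          by (intro mult_left_mono clamp_error that nonneg z)
      qed
      also have "\<dots> = E N / k\<^sup>2"
        unfolding E_def S_def sum_divide_distrib sum.distrib[symmetric]
        by (rule sum.cong) (simp_all add: field_simps power_add power2_eq_square)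
      finally show ?thesis .
    qed
    have le: "\<bar>(LINT t|M. F k m n t) - s m n\<bar> \<le> D / k\<^sup>2" if "k > 0" for k
      by (rule LIMSEQ_le[OF tendsto_rabs[OF tendsto_diff[OF limF limS]] tendsto_divide[OF limE tendsto_const]])
        (use that err in auto)
    have "(\<lambda>k. D / (real (Suc k))\<^sup>2) \<longlonglongrightarrow> 0" by real_asymp
    then have "(\<lambda>k. (LINT t|M. F (real (Suc k)) m n t) - s m n) \<longlonglongrightarrow> 0"
      by (rule Lim_null_comparison[rotated]) (use le in simp)
    then show ?thesis by (simp add: LIM_zero_iff)
  qed
  have eq: "(LINT t|M. x t ^ m * y t ^ n) = s m n" for m n
    using lim1 lim2 by (rule LIMSEQ_unique)
  have meas: "(\<lambda>t. (x t, y t)) \<in> M \<rightarrow>\<^sub>M borel" by measurable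
  show ?thesis
  proof (intro exI conjI allI)
    fix m n
    show "integrable (distr M borel (\<lambda>t. (x t, y t))) (\<lambda>z. fst z ^ m * snd z ^ n)"
      by (subst integrable_distr_eq[OF meas]) (simp_all add: int measurable_monomial)
    show "(LINT z|distr M borel (\<lambda>t. (x t, y t)). fst z ^ m * snd z ^ n) = s m n"
      by (subst integral_distr[OF meas]) (simp_all add: eq measurable_monomial)
  qed simp
qed


text \<open>
Normalization to total mass one. This form with explicit error bounds is the one that the applications provide.
\<close>

theorem limit_of_atomic_measures:
  fixes s :: "nat \<Rightarrow> nat \<Rightarrow> real"
  assumes pos: "s 0 0 > 0"
    and approx: "\<And>K e. e > 0 \<Longrightarrow> \<exists>A w. finite A \<and> (\<forall>z\<in>A. 0 \<le> w z) \<and>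
      (\<forall>m\<le>K. \<forall>n\<le>K. \<bar>(\<Sum>z\<in>A. w z * (fst z ^ m * snd z ^ n)) - s m n\<bar> < e)"
  shows "\<exists>\<mu>. sets \<mu> = sets borel \<and>
    (\<forall>m n. integrable \<mu> (\<lambda>z. fst z ^ m * snd z ^ n) \<and> (LINT z|\<mu>. fst z ^ m * snd z ^ n) = s m n)"
proof -
  define e where "e N = min (s 0 0 / 2) (1 / real (Suc N))" for N
  have e: "e N > 0" "e N \<le> s 0 0 / 2" "e N \<le> 1 / real (Suc N)" for N using pos by (simp_all add: e_def)
  define P where "P N A w \<longleftrightarrow> finite A \<and> (\<forall>z\<in>A. 0 \<le> w z) \<and>
      (\<forall>m\<le>N. \<forall>n\<le>N. \<bar>(\<Sum>z\<in>A. w z * (fst z ^ m * snd z ^ n)) - s m n\<bar> < e N)"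
    for N and A :: "(real \<times> real) set" and w :: "real \<times> real \<Rightarrow> real"
  have "\<exists>A w. P N A w" for N unfolding P_def using approx[OF e(1)] .
  then obtain A w where "\<And>N. P N (A N) (w N)" by metis
  then have A: "\<And>N. finite (A N)" "\<And>N z. z \<in> A N \<Longrightarrow> 0 \<le> w N z"
    "\<And>N m n. m \<le> N \<Longrightarrow> n \<le> N \<Longrightarrow> \<bar>(\<Sum>z\<in>A N. w N z * (fst z ^ m * snd z ^ n)) - s m n\<bar> < e N"
    unfolding P_def by blast+
  define W where "W N = (\<Sum>z\<in>A N. w N z)" for N
  have W: "W N > 0" for N using A(3)[of 0 N 0] e(2)[of N] pos by (simp add: W_def)
  have lim: "(\<lambda>N. \<Sum>z\<in>A N. w N z * (fst z ^ m * snd z ^ n)) \<longlonglongrightarrow> s m n" for m n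
  proof -
    have "\<forall>\<^sub>F N in sequentially. norm ((\<Sum>z\<in>A N. w N z * (fst z ^ m * snd z ^ n)) - s m n) \<le> 1 / real (Suc N)"
      using eventually_ge_at_top[of "max m n"]
    proof eventually_elim
      case (elim N)
      then show ?case using A(3)[of m N n] e(3)[of N] by simp
    qed
    moreover have "(\<lambda>N. 1 / real (Suc N)) \<longlonglongrightarrow> 0" by real_asymp
    ultimately have "(\<lambda>N. (\<Sum>z\<in>A N. w N z * (fst z ^ m * snd z ^ n)) - s m n) \<longlonglongrightarrow> 0"
      by (rule Lim_null_comparison)
    then show ?thesis by (simp add: LIM_zero_iff)
  qed
  have limW: "W \<longlonglongrightarrow> s 0 0" using lim[of 0 0] unfolding W_def[abs_def] by simp
  have "\<exists>\<mu>. sets \<mu> = sets borel \<and>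
    (\<forall>m n. integrable \<mu> (\<lambda>z. fst z ^ m * snd z ^ n) \<and> (LINT z|\<mu>. fst z ^ m * snd z ^ n) = s m n / s 0 0)"
  proof (rule limit_of_atomic_probabilities)
    show "finite (A N)" for N by (rule A(1))
    show "0 \<le> w N z / W N" if "z \<in> A N" for N z using A(2)[OF that] W[of N] by simp
    show "(\<Sum>z\<in>A N. w N z / W N) = 1" for N using W[of N] by (simp add: W_def flip: sum_divide_distrib)
    show "(\<lambda>N. \<Sum>z\<in>A N. w N z / W N * (fst z ^ m * snd z ^ n)) \<longlonglongrightarrow> s m n / s 0 0" for m n
      using tendsto_divide[OF lim[of m n] limW] pos by (simp add: sum_divide_distrib)
  qed
  then obtain \<mu> where \<mu>: "sets \<mu> = sets borel" "\<And>m n. integrable \<mu> (\<lambda>z. fst z ^ m * snd z ^ n)"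
    "\<And>m n. (LINT z|\<mu>. fst z ^ m * snd z ^ n) = s m n / s 0 0" by blast
  show ?thesis
  proof (intro exI conjI allI)
    show "sets (density \<mu> (\<lambda>_. ennreal (s 0 0))) = sets borel" using \<mu>(1) by simp
    fix m n
    have meas: "(\<lambda>z. fst z ^ m * snd z ^ n) \<in> borel_measurable \<mu>"
      using \<mu>(2) by (rule borel_measurable_integrable)
    show "integrable (density \<mu> (\<lambda>_. ennreal (s 0 0))) (\<lambda>z. fst z ^ m * snd z ^ n)"
      using pos \<mu>(2)[of m n] by (subst integrable_density[OF meas]) simp_all
    show "(LINT z|density \<mu> (\<lambda>_. ennreal (s 0 0)). fst z ^ m * snd z ^ n) = s m n"
      using pos by (subst integral_density[OF meas]) (simp_all add: \<mu>)
  qed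
qed

section \<open>Hamburger's theorem\<close>

lemma finite_moment_measures1_integrable:
  assumes "\<mu> \<in> finite_moment_measures1"
  shows "integrable \<mu> (\<lambda>x. poly p (complex_of_real x))"
proof -
  have "integrable \<mu> (\<lambda>x. complex_of_real (x ^ i))" for i
    using assms by (intro integrable_of_real) (simp add: finite_moment_measures1_def)
  then show ?thesis unfolding poly_altdef by (intro Bochner_Integration.integrable_sum) auto
qed

lemma represents1I:
  assumes "positive1 l" "sets \<mu> = sets borel" "\<And>n. integrable \<mu> (\<lambda>x. x ^ n)"
    and "\<And>n. l (monom 1 n) = complex_of_real (LINT x|\<mu>. x ^ n)"
  shows "represents1 \<mu> l"
proof -
  interpret star_functional "\<lambda>c. [:c:]" conj1 l by fact
  have int: "integrable \<mu> (\<lambda>x. complex_of_real x ^ n)" for n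
    using integrable_of_real[OF assms(3)[of n], where 'a = complex] by simp
  have "l p = (LINT x|\<mu>. poly p (complex_of_real x))" for p
  proof -
    have "l p = l (\<Sum>i\<le>degree p. [:coeff p i:] * monom 1 i)"
      by (simp add: smult_monom poly_as_sum_of_monoms)
    also have "\<dots> = (\<Sum>i\<le>degree p. coeff p i * complex_of_real (LINT x|\<mu>. x ^ i))"
      by (simp only: sum scale assms(4))
    also have "\<dots> = (\<Sum>i\<le>degree p. LINT x|\<mu>. coeff p i * complex_of_real x ^ i)"
      by (rule sum.cong) (simp_all flip: integral_complex_of_real)
    also have "\<dots> = (LINT x|\<mu>. poly p (complex_of_real x))"
      unfolding poly_altdef by (subst Bochner_Integration.integral_sum) (use int in auto)
    finally show ?thesis .
  qed
  then show ?thesis using assms by (simp add: represents1_def finite_moment_measures1_def)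
qed

text \<open>
Quadrature nodes of increasing order, placed on the first coordinate axis, approximate the moments; the
limit measure is projected back to the line. If $l(1)=0$, Cauchy-Schwarz forces $l=0$.
\<close>

theorem hamburger:
  assumes "positive1 l"
  shows "\<exists>\<mu>. represents1 \<mu> l"
proof -
  interpret star_functional "\<lambda>c. [:c:]" conj1 l by fact
  have real: "l (monom 1 n) = complex_of_real (Re (l (monom 1 n)))" for n
    using hermitian[of "monom 1 n"] by (simp add: map_poly_monom complex_eq_iff)
  show ?thesis
  proof (cases "l 1 = 0")
    case True
    then have "nrm 1 = 0" by (simp add: nrm_def)
    then have "l p = 0" for p using eq_0_if_nrm_0[of 1 p] by simp
    then have "represents1 (null_measure borel) l"
      by (intro represents1I[OF assms]) auto
    then show ?thesis ..
  next
    case False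
    define s where "s m n = (if n = 0 then Re (l (monom 1 m)) else 0)" for m n :: nat
    have "l 1 \<in> \<real>\<^sub>\<ge>\<^sub>0" using pos[of 1] by simp
    then have s00: "s 0 0 > 0" using False
      by (auto simp: s_def complex_nonneg_Reals_iff complex_eq_iff monom_0 simp flip: one_pCons)
    have atoms: "\<exists>A w. finite A \<and> (\<forall>z\<in>A. 0 \<le> w z) \<and>
      (\<forall>m\<le>K. \<forall>n\<le>K. \<bar>(\<Sum>z\<in>A. w z * (fst z ^ m * snd z ^ n)) - s m n\<bar> < e)" if "e > 0" for K and e :: real
    proof -
      obtain Z c where Z: "finite Z" "\<And>z. z \<in> Z \<Longrightarrow> c z \<ge> 0"
        "\<And>p. degree p < Suc K \<Longrightarrow> l p = (\<Sum>z\<in>Z. complex_of_real (c z) * poly p (complex_of_real z))"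
        using gauss_quadrature[OF assms, of "Suc K"] by blast
      have inj: "inj_on (\<lambda>z. (z, 0::real)) Z" by (auto simp: inj_on_def)
      have "(\<Sum>z\<in>(\<lambda>z. (z, 0)) ` Z. (c \<circ> fst) z * (fst z ^ m * snd z ^ n)) = s m n" if "m \<le> K" for m n
      proof -
        have "l (monom 1 m) = complex_of_real (\<Sum>z\<in>Z. c z * z ^ m)"
          using Z(3)[of "monom 1 m"] that by (simp add: degree_monom_eq poly_monom)
        then show ?thesis unfolding sum.reindex[OF inj] by (simp add: s_def power_0_left)
      qed
      then show ?thesis using Z that
        by (intro exI[of _ "(\<lambda>z. (z, 0)) ` Z"] exI[of _ "c \<circ> fst"]) auto
    qed
    obtain \<mu> :: "(real \<times> real) measure" where \<mu>: "sets \<mu> = sets borel"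
      "\<And>m n. integrable \<mu> (\<lambda>z. fst z ^ m * snd z ^ n)" "\<And>m n. (LINT z|\<mu>. fst z ^ m * snd z ^ n) = s m n"
      using limit_of_atomic_measures[OF s00 atoms] by blast
    have "(\<lambda>z. fst z ^ 1 * snd z ^ 0) \<in> borel_measurable \<mu>"
      using \<mu>(2) by (rule borel_measurable_integrable)
    then have fst: "fst \<in> \<mu> \<rightarrow>\<^sub>M borel" by simp
    have "represents1 (distr \<mu> borel fst) l"
    proof (rule represents1I[OF assms])
      show "integrable (distr \<mu> borel fst) (\<lambda>x. x ^ n)" for n
        using \<mu>(2)[of n 0] by (subst integrable_distr_eq[OF fst]) simp_all
      show "l (monom 1 n) = complex_of_real (LINT x|distr \<mu> borel fst. x ^ n)" for n
        using \<mu>(3)[of n 0] real[of n] by (subst integral_distr[OF fst]) (simp_all add: s_def)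
    qed simp
    then show ?thesis ..
  qed
qed

section \<open>Determinacy and polynomial approximation\<close>

text \<open>
The functional of $d\mu/(1+x^2)$.
\<close>

definition damped :: "real measure \<Rightarrow> complex poly \<Rightarrow> complex" where
  "damped \<mu> p = (LINT x|\<mu>. poly p (complex_of_real x) / complex_of_real (1 + x\<^sup>2))"

lemma integrable_damped:
  assumes "\<mu> \<in> finite_moment_measures1"
  shows "integrable \<mu> (\<lambda>x. poly p (complex_of_real x) / complex_of_real (1 + x\<^sup>2))"
proof (rule Bochner_Integration.integrable_bound)
  show "integrable \<mu> (\<lambda>x. poly p (complex_of_real x))"
    using assms by (rule finite_moment_measures1_integrable)
  have [measurable_cong]: "sets \<mu> = sets borel" using assms by (simp add: finite_moment_measures1_def)
  show "(\<lambda>x. poly p (complex_of_real x) / complex_of_real (1 + x\<^sup>2)) \<in> borel_measurable \<mu>"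
    unfolding poly_altdef by measurable
  have "cmod (poly p (complex_of_real x) / complex_of_real (1 + x\<^sup>2)) \<le> cmod (poly p (complex_of_real x))" for x
  proof -
    have "1 + x\<^sup>2 \<ge> 1" by simp
    then have "cmod (poly p (complex_of_real x)) / (1 + x\<^sup>2) \<le> cmod (poly p (complex_of_real x)) / 1"
      by (intro divide_left_mono) (auto simp: add_pos_nonneg)
    then show ?thesis by (simp only: norm_divide norm_of_real abs_of_nonneg) simp
  qed
  then show "AE x in \<mu>. norm (poly p (complex_of_real x) / complex_of_real (1 + x\<^sup>2)) \<le> norm (poly p (complex_of_real x))"
    by simp
qed

lemma one_plus_square_nz: "complex_of_real (1 + x\<^sup>2) \<noteq> 0"
  by (metis add_pos_nonneg less_irrefl of_real_eq_0_iff zero_le_power2 zero_less_one)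

lemma damped_mult:
  assumes "represents1 \<mu> l"
  shows "damped \<mu> ([:1, 0, 1:] * p) = l p"
proof -
  have "poly ([:1, 0, 1:] * p) (complex_of_real x) / complex_of_real (1 + x\<^sup>2) = poly p (complex_of_real x)" for x
  proof -
    have "poly ([:1, 0, 1:] * p) (complex_of_real x) = complex_of_real (1 + x\<^sup>2) * poly p (complex_of_real x)"
      by (simp add: power2_eq_square algebra_simps)
    then show ?thesis using one_plus_square_nz[of x] by simp
  qed
  then show ?thesis using assms by (simp add: damped_def represents1_def)
qed

lemma positive1_damped:
  assumes "\<mu> \<in> finite_moment_measures1"
  shows "positive1 (damped \<mu>)"
proof (rule positive1I)
  note int = integrable_damped[OF assms]
  show "damped \<mu> (p + q) = damped \<mu> p + damped \<mu> q" for p q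
    unfolding damped_def by (subst Bochner_Integration.integral_add[symmetric]) (simp_all only: int poly_add add_divide_distrib)
  show "damped \<mu> (smult c p) = c * damped \<mu> p" for c p
    unfolding damped_def by (subst integral_mult_right_zero[symmetric]) (simp add: mult.assoc)
  fix p
  have "damped \<mu> (p * conj1 p) = (LINT x|\<mu>. complex_of_real ((cmod (poly p (complex_of_real x)))\<^sup>2 / (1 + x\<^sup>2)))"
    unfolding damped_def by (rule Bochner_Integration.integral_cong) (simp_all add: complex_norm_square del: of_real_power)
  also have "\<dots> = complex_of_real (LINT x|\<mu>. (cmod (poly p (complex_of_real x)))\<^sup>2 / (1 + x\<^sup>2))"
    by (rule integral_complex_of_real)
  finally show "damped \<mu> (p * conj1 p) \<in> \<real>\<^sub>\<ge>\<^sub>0" by (simp add: complex_nonneg_Reals_iff)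
qed

text \<open>
The perturbed functional $l'$ satisfies $l'((1+x^2)p)=l(p)$, since $1+x^2$ vanishes at $\pm\mathrm{i}$.
If $l'$ were positive, it would have a representing measure $\kappa$, and $(1+x^2)\,d\kappa$ would represent
$l$. By uniqueness this is $\mu$, so $l'$ is the unperturbed functional, and its values at $1$
and $x$ show $a=0$.
\<close>

lemma determinate_no_perturbation:
  assumes det: "determinate1 l" and rep: "represents1 \<mu> l" and "a \<noteq> 0"
  shows "\<exists>f. Re (damped \<mu> (f * conj1 f)) + 2 * Re (a * poly f \<i> * cnj (poly f (- \<i>))) < 0"
proof (rule ccontr)
  assume neg: "\<not> ?thesis"
  have mu: "\<mu> \<in> finite_moment_measures1" using rep by (simp add: represents1_def)
  interpret D: star_functional "\<lambda>c. [:c:]" conj1 "damped \<mu>" by (rule positive1_damped[OF mu])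
  define l' where "l' p = damped \<mu> p + a * poly p \<i> + cnj a * poly p (- \<i>)" for p
  have "positive1 l'"
  proof (rule positive1I)
    show "l' (p + q) = l' p + l' q" for p q by (simp add: l'_def D.add algebra_simps)
    show "l' (smult c p) = c * l' p" for c p using D.scale[of c p] by (simp add: l'_def algebra_simps)
    fix p
    define w where "w = a * poly p \<i> * cnj (poly p (- \<i>))"
    have "l' (p * conj1 p) = damped \<mu> (p * conj1 p) + (w + cnj w)"
      by (simp add: l'_def w_def algebra_simps)
    moreover have "w + cnj w = complex_of_real (2 * Re w)" by (rule complex_add_cnj)
    ultimately show "l' (p * conj1 p) \<in> \<real>\<^sub>\<ge>\<^sub>0"
      using neg D.pos_Im[of p] by (auto simp: complex_nonneg_Reals_iff w_def not_less)
  qed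
  then obtain \<kappa> where \<kappa>: "represents1 \<kappa> l'" using hamburger by blast
  have ka: "\<kappa> \<in> finite_moment_measures1" "sets \<kappa> = sets borel"
    using \<kappa> by (auto simp: represents1_def finite_moment_measures1_def)
  note [measurable_cong] = ka(2)
  define \<mu>' where "\<mu>' = density \<kappa> (\<lambda>x. ennreal (1 + x\<^sup>2))"
  have meas: "(\<lambda>x. 1 + x\<^sup>2) \<in> borel_measurable \<kappa>" by measurable
  have nonneg: "AE x in \<kappa>. 0 \<le> 1 + x\<^sup>2" by simp
  have measp: "(\<lambda>x. poly p (complex_of_real x)) \<in> borel_measurable \<kappa>" for p
    unfolding poly_altdef by measurable
  have "represents1 \<mu>' l"
    unfolding represents1_def finite_moment_measures1_def
  proof (intro conjI CollectI allI)
    show "sets \<mu>' = sets borel" using ka(2) by (simp add: \<mu>'_def)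
    fix n
    have "integrable \<kappa> (\<lambda>x. x ^ k)" for k using ka(1) by (simp add: finite_moment_measures1_def)
    then have "integrable \<kappa> (\<lambda>x. x ^ n + x ^ (n + 2))" by (intro Bochner_Integration.integrable_add)
    then show "integrable \<mu>' (\<lambda>x. x ^ n)"
      unfolding \<mu>'_def using meas nonneg by (subst integrable_density) (auto simp: algebra_simps power2_eq_square)
  next
    fix p
    have "(LINT x|\<mu>'. poly p (complex_of_real x)) = (LINT x|\<kappa>. poly ([:1, 0, 1:] * p) (complex_of_real x))"
      unfolding \<mu>'_def using meas nonneg measp
      by (subst integral_density) (auto simp: scaleR_conv_of_real power2_eq_square algebra_simps)
    also have "\<dots> = l' ([:1, 0, 1:] * p)" using \<kappa> by (simp add: represents1_def)
    also have "\<dots> = l p" unfolding l'_def damped_mult[OF rep] by simp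
    finally show "l p = (LINT x|\<mu>'. poly p (complex_of_real x))" by simp
  qed
  then have "\<mu>' = \<mu>" using det rep unfolding determinate1_def by blast
  have "damped \<mu> p = l' p" for p
  proof -
    have "damped \<mu> p = (LINT x|\<mu>'. poly p (complex_of_real x) / complex_of_real (1 + x\<^sup>2))"
      by (simp add: damped_def \<open>\<mu>' = \<mu>\<close>)
    also have "\<dots> = (LINT x|\<kappa>. (1 + x\<^sup>2) *\<^sub>R (poly p (complex_of_real x) / complex_of_real (1 + x\<^sup>2)))"
      unfolding \<mu>'_def by (rule integral_density) (use meas nonneg measp in measurable)
    also have "\<dots> = (LINT x|\<kappa>. poly p (complex_of_real x))"
      by (rule Bochner_Integration.integral_cong) (use one_plus_square_nz in \<open>simp_all add: scaleR_conv_of_real\<close>)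
    also have "\<dots> = l' p" using \<kappa> by (simp add: represents1_def)
    finally show ?thesis .
  qed
  from this[of 1] this[of "[:0, 1:]"] have "a + cnj a = 0" "a * \<i> - cnj a * \<i> = 0"
    by (simp_all add: l'_def)
  then have "a = 0" by (simp add: complex_eq_iff)
  then show False using \<open>a \<noteq> 0\<close> by simp
qed

text \<open>
Let \<open>B\<close> collect the values at $-\mathrm{i}$ of the polynomials $f$ with $f(\mathrm{i})=1$ whose seminorm with
respect to the damped measure is below $r$. This is a convex set of complex numbers. If $0$ were not in it, a separating
direction, scaled to length $r^2/2$ and used as a perturbation, would yield an element of \<open>B\<close> on the
wrong side of the separating line. An $f$ with $f(-\mathrm{i})=0$ has the form $(x+\mathrm{i})k$, the damping factor cancels
$|x+\mathrm{i}|^2$, and the normalized $k$ is the required polynomial.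
\<close>

theorem determinate_approximation:
  assumes det: "determinate1 l" and "d > 0"
  shows "\<exists>g. poly g \<i> = 1 \<and> Re (l (g * conj1 g)) < d"
proof -
  obtain \<mu> where rep: "represents1 \<mu> l" using det unfolding determinate1_def by blast
  then have mu: "\<mu> \<in> finite_moment_measures1" by (simp add: represents1_def)
  interpret D: star_functional "\<lambda>c. [:c:]" conj1 "damped \<mu>" by (rule positive1_damped[OF mu])
  define r where "r = sqrt d / 2"
  have r: "r > 0" using assms by (simp add: r_def)
  define B where "B = {poly f (- \<i>) | f. poly f \<i> = 1 \<and> D.nrm f < r \<and> cmod (poly f (- \<i>)) \<le> 1}"
  have "convex B"
  proof (rule convexI)
    fix x y and u v :: real assume "x \<in> B" "y \<in> B" and uv: "0 \<le> u" "0 \<le> v" "u + v = 1"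
    then obtain f g where f: "x = poly f (- \<i>)" "poly f \<i> = 1" "D.nrm f < r" "cmod x \<le> 1"
      and g: "y = poly g (- \<i>)" "poly g \<i> = 1" "D.nrm g < r" "cmod y \<le> 1"
      unfolding B_def by blast
    define h where "h = [:complex_of_real u:] * f + [:complex_of_real v:] * g"
    have "D.nrm h \<le> u * D.nrm f + v * D.nrm g"
      unfolding h_def by (rule order_trans[OF D.nrm_triangle]) (use uv in \<open>simp add: D.nrm_scale del: mult_pCons_left\<close>)
    also have "\<dots> < r" using f(3) g(3) uv by (rule convex_bound_lt)
    finally have "D.nrm h < r" .
    moreover have "poly h \<i> = 1" using f g uv by (simp add: h_def flip: of_real_add)
    moreover have eq: "poly h (- \<i>) = u *\<^sub>R x + v *\<^sub>R y" by (simp add: h_def f g scaleR_conv_of_real)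
    moreover have "cmod (u *\<^sub>R x + v *\<^sub>R y) \<le> u * cmod x + v * cmod y"
      using uv norm_triangle_ineq[of "u *\<^sub>R x" "v *\<^sub>R y"] by simp
    then have "cmod (u *\<^sub>R x + v *\<^sub>R y) \<le> 1" using f g uv convex_bound_le[of "cmod x" 1 "cmod y" u v] by simp
    ultimately show "u *\<^sub>R x + v *\<^sub>R y \<in> B" unfolding B_def by (intro CollectI exI[of _ h]) simp
  qed
  have "0 \<in> B"
  proof (rule ccontr)
    assume "0 \<notin> B"
    then obtain u where u: "u \<noteq> 0" "\<And>\<beta>. \<beta> \<in> B \<Longrightarrow> 0 \<le> inner u \<beta>"
      using separating_hyperplane_set_0[OF \<open>convex B\<close>] by blast
    define a where "a = (r\<^sup>2 / (2 * cmod u)) *\<^sub>R u"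
    have a: "a \<noteq> 0" "cmod a = r\<^sup>2 / 2" using u r by (simp_all add: a_def)
    obtain f where "(D.nrm f)\<^sup>2 + 2 * Re (a * poly f \<i> * cnj (poly f (- \<i>))) < 0"
      using determinate_no_perturbation[OF det rep a(1)] unfolding D.nrm_sq by blast
    then obtain f where f: "(D.nrm f)\<^sup>2 + 2 * Re (a * poly f \<i> * cnj (poly f (- \<i>))) < 0"
      and le: "cmod (poly f (- \<i>)) \<le> cmod (poly f \<i>)"
    \<comment> \<open>Conjugating the coefficients exchanges the moduli at the two points and keeps the inequality.\<close>
    proof (cases "cmod (poly f (- \<i>)) \<le> cmod (poly f \<i>)")
      case False
      then show ?thesis using that[of "conj1 f"] \<open>(D.nrm f)\<^sup>2 + _ < 0\<close>
        by (simp add: D.nrm_sq mult_ac)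
    qed
    have "poly f \<i> \<noteq> 0" using f by (auto simp: not_less)
    define c where "c = inverse (poly f \<i>)"
    define F where "F = [:c:] * f"
    define \<beta> where "\<beta> = poly F (- \<i>)"
    have F1: "poly F \<i> = 1" using \<open>poly f \<i> \<noteq> 0\<close> by (simp add: F_def c_def)
    have \<beta>1: "cmod \<beta> \<le> 1" using le \<open>poly f \<i> \<noteq> 0\<close> by (simp add: \<beta>_def F_def c_def field_simps norm_divide)
    have "(D.nrm F)\<^sup>2 + 2 * Re (a * cnj \<beta>) = (cmod c)\<^sup>2 * ((D.nrm f)\<^sup>2 + 2 * Re (a * poly f \<i> * cnj (poly f (- \<i>))))"
    proof -
      have "a * cnj \<beta> = complex_of_real ((cmod c)\<^sup>2) * (a * poly f \<i> * cnj (poly f (- \<i>)))"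
      proof -
        have "complex_of_real ((cmod c)\<^sup>2) * (a * poly f \<i> * cnj (poly f (- \<i>)))
            = (c * poly f \<i>) * (a * cnj (c * poly f (- \<i>)))"
          unfolding complex_norm_square by (simp add: mult_ac)
        also have "c * poly f \<i> = 1" using F1 by (simp add: F_def)
        finally show ?thesis by (auto simp: \<beta>_def F_def)
      qed
      then have "Re (a * cnj \<beta>) = (cmod c)\<^sup>2 * Re (a * poly f \<i> * cnj (poly f (- \<i>)))"
        by (simp only: scaleR_conv_of_real[symmetric] scaleR_complex.sel)
      then show ?thesis unfolding F_def D.nrm_scale by (simp add: power_mult_distrib algebra_simps)
    qed
    also have "\<dots> < 0" using f \<open>poly f \<i> \<noteq> 0\<close> by (intro mult_pos_neg) (simp_all add: c_def)
    finally have lt: "(D.nrm F)\<^sup>2 < - 2 * Re (a * cnj \<beta>)" by simp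
    also have "\<dots> \<le> 2 * (cmod a * cmod \<beta>)"
      using complex_Re_le_cmod[of "- (a * cnj \<beta>)"] by (simp add: norm_mult)
    also have "\<dots> \<le> r\<^sup>2" using \<beta>1 a(2) mult_left_mono[of "cmod \<beta>" 1 "cmod a"] by simp
    finally have "D.nrm F < r" using r by (simp add: power_less_imp_less_base)
    then have "\<beta> \<in> B" using F1 \<beta>1 unfolding B_def \<beta>_def by blast
    then have "0 \<le> inner u \<beta>" by (rule u(2))
    moreover have "Re (a * cnj \<beta>) = r\<^sup>2 / (2 * cmod u) * inner u \<beta>"
      by (simp add: a_def inner_complex_def algebra_simps)
    moreover have "0 \<le> r\<^sup>2 / (2 * cmod u)" by simp
    ultimately have "Re (a * cnj \<beta>) \<ge> 0" by (metis mult_nonneg_nonneg)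
    moreover have "(D.nrm F)\<^sup>2 \<ge> 0" by simp
    ultimately show False using lt by linarith
  qed
  then obtain f where f: "poly f (- \<i>) = 0" "poly f \<i> = 1" "D.nrm f < r" unfolding B_def by force
  from f(1) obtain k where k: "f = [:\<i>, 1:] * k" by (metis dvdE minus_minus poly_eq_0_iff_dvd)
  define g where "g = [:2 * \<i>:] * k"
  have "f * conj1 f = [:1, 0, 1:] * (k * conj1 k)"
  proof -
    have "conj1 [:\<i>, 1:] = [:-\<i>, 1:]" "[:\<i>, 1:] * [:-\<i>, 1:] = [:1, 0, 1:]" by (simp_all add: map_poly_pCons)
    then show ?thesis by (simp only: k conj1_mult) (metis (no_types) mult.assoc mult.left_commute)
  qed
  then have lk: "l (k * conj1 k) = damped \<mu> (f * conj1 f)" by (simp only: damped_mult[OF rep])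
  have "g * conj1 g = [:4:] * (k * conj1 k)"
    by (simp add: g_def map_poly_smult)
  then have "damped \<mu> ([:1, 0, 1:] * (g * conj1 g)) = damped \<mu> ([:4:] * ([:1, 0, 1:] * (k * conj1 k)))"
    by (simp only: mult_ac)
  then have "l (g * conj1 g) = 4 * damped \<mu> (f * conj1 f)"
    by (simp only: D.scale damped_mult[OF rep] lk)
  then have "Re (l (g * conj1 g)) = 4 * (D.nrm f)\<^sup>2" by (simp add: D.nrm_sq)
  also have "\<dots> < 4 * r\<^sup>2" using f(3) by (simp add: power_strict_mono)
  also have "\<dots> = d" using assms by (simp add: r_def power_divide)
  finally have "Re (l (g * conj1 g)) < d" .
  moreover have "poly g \<i> = 1" using f(2) by (simp add: k g_def mult.assoc)
  ultimately show ?thesis by blast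
qed

section \<open>Adjoining a resolvent\<close>

definition X1_minus_i :: "complex poly poly" where "X1_minus_i = x1_poly [:-\<i>, 1:]"

definition weighted :: "(complex poly poly \<Rightarrow> complex) \<Rightarrow> complex poly poly \<Rightarrow> complex" where
  "weighted L f = L ((X2\<^sup>2 + 1) * f)"

text \<open>
The multiples of $x_1-\mathrm{i}$ are dense for the stronger form with the weight $x_2^2+1$. This is a
polynomial substitute for essential self-adjointness of multiplication by $x_1$ in that form.
\<close>

definition resolvent_dense :: "(complex poly poly \<Rightarrow> complex) \<Rightarrow> bool" where
  "resolvent_dense L \<longleftrightarrow> (\<forall>f. \<forall>d>0. \<exists>h. star_functional.nrm conj2 (weighted L) (X1_minus_i * h - f) < d)"

lemma conj2_X2: "conj2 X2 = X2"
  by (simp add: X2_def conj2_def map_poly_pCons)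

lemma conj2_X1_minus_i: "conj2 X1_minus_i = X1_minus_i + const2 (2 * \<i>)"
  by (simp add: X1_minus_i_def conj2_x1_poly map_poly_pCons) (simp add: x1_poly_def)

lemma X2_square_plus_one: "X2\<^sup>2 + 1 = (X2 + const2 \<i>) * conj2 (X2 + const2 \<i>)"
  by (simp add: conj2_add conj2_X2) (simp add: X2_def power2_eq_square one_pCons)

lemma weighted_square: "weighted L (f * conj2 f) = L (((X2 + const2 \<i>) * f) * conj2 ((X2 + const2 \<i>) * f))"
  unfolding weighted_def X2_square_plus_one conj2_mult by (simp only: mult_ac)

lemma positive2_weighted:
  assumes "positive2 L"
  shows "positive2 (weighted L)"
proof -
  interpret star_functional const2 conj2 L by fact
  show ?thesis
  proof (rule positive2I)
    show "weighted L (const2 c * p) = c * weighted L p" for c p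
      unfolding weighted_def mult.left_commute[of _ "const2 c"] by (rule scale)
    show "weighted L (p * conj2 p) \<in> \<real>\<^sub>\<ge>\<^sub>0" for p unfolding weighted_square by (rule pos)
  qed (simp add: weighted_def distrib_left add)
qed

text \<open>
The generator $x_1-\mathrm{i}$ takes the place of $x_1$, since resolvents interact
directly with it.
\<close>

lemma poly2_induct [case_names const X1 X2 add mult]:
  assumes const: "\<And>c. P (const2 c)" and X1: "P X1_minus_i" and X2: "P X2"
    and add: "\<And>f g. P f \<Longrightarrow> P g \<Longrightarrow> P (f + g)" and mult: "\<And>f g. P f \<Longrightarrow> P g \<Longrightarrow> P (f * g)"
  shows "P f"
proof -
  have P1: "P [:a:]" for a
  proof (induction a)
    case 0
    show ?case using const[of 0] by simp
  next
    case (pCons c a)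
    have "[:pCons c a:] = const2 c + (X1_minus_i + const2 \<i>) * [:a:]"
      by (simp add: X1_minus_i_def x1_poly_def)
    then show ?case using pCons by (simp only: const X1 add mult)
  qed
  show ?thesis
  proof (induction f)
    case 0
    show ?case using const[of 0] by simp
  next
    case (pCons a f)
    have "pCons a f = [:a:] + X2 * f" by (simp add: X2_def)
    then show ?case using pCons by (simp only: P1 X2 add mult)
  qed
qed

lemma Cauchy_if_dist_le_add:
  fixes z :: "nat \<Rightarrow> 'a::metric_space"
  assumes "e \<longlonglongrightarrow> (0::real)" "\<And>m n. dist (z m) (z n) \<le> e m + e n"
  shows "Cauchy z"
proof (rule metric_CauchyI)
  fix r :: real assume "r > 0"
  then have "\<forall>\<^sub>F n in sequentially. e n < r / 2" using assms(1) by (intro order_tendstoD) auto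
  then obtain N where "\<And>n. n \<ge> N \<Longrightarrow> e n < r / 2" unfolding eventually_sequentially by blast
  then show "\<exists>M. \<forall>m\<ge>M. \<forall>n\<ge>M. dist (z m) (z n) < r"
    using assms(2) by (intro exI[of _ N]) (smt (verit) field_sum_of_halves)
qed

text \<open>
The relation \<open>app f h\<close> says that the sequence $h$ converges to the resolvent $(x_1-\mathrm{i})^{-1}f$. As
$\|h\|\le\|(x_1-\mathrm{i})h\|$, such sequences are Cauchy, and \<open>B f g\<close> is the limit of their inner products. To
see that \<open>B f g\<close> depends only on $f\overline{g}$, it is enough to move each generator from one argument to the other. For
$x_2$ this needs sequences $h$ for which $x_2h$ still converges; they exist because the
density hypothesis controls the seminorm with the weight $x_2^2+1$. The new seminorms are bounded by the old
ones, so the density property is inherited.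
\<close>

theorem adjoin_resolvent:
  assumes pos: "positive2 L" and dense: "resolvent_dense L"
  shows "\<exists>L'. positive2 L' \<and> resolvent_dense L' \<and> (\<forall>f. L' (X1_minus_i * conj2 X1_minus_i * f) = L f)"
proof -
  interpret L: star_functional const2 conj2 L by fact
  interpret W: star_functional const2 conj2 "weighted L" by (rule positive2_weighted[OF pos])
  have W_sq: "(W.nrm f)\<^sup>2 = (L.nrm (X2 * f))\<^sup>2 + (L.nrm f)\<^sup>2" for f
  proof -
    have "weighted L (f * conj2 f) = L ((X2 * f) * conj2 (X2 * f)) + L (f * conj2 f)"
      unfolding weighted_def by (simp add: L.star_mult conj2_X2 L.add[symmetric] algebra_simps power2_eq_square)
    then show ?thesis unfolding W.nrm_sq L.nrm_sq by simp
  qed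
  have L_le_W: "L.nrm f \<le> W.nrm f" for f
    by (rule power2_le_imp_le) (simp_all add: W_sq)
  have X2_le_W: "L.nrm (X2 * f) \<le> W.nrm f" for f
    by (rule power2_le_imp_le) (simp_all add: W_sq)
  have le_X1_minus_i: "L.nrm f \<le> L.nrm (X1_minus_i * f)" for f
  proof (rule power2_le_imp_le)
    let ?X = "X1_minus_i + const2 \<i>"
    have X: "conj2 ?X = ?X" by (simp add: L.star_add conj2_X1_minus_i)
    have "X1_minus_i * conj2 X1_minus_i = ?X * ?X + 1" unfolding conj2_X1_minus_i by (simp add: X1_minus_i_def x1_poly_def one_pCons)
    moreover have "(X1_minus_i * f) * conj2 (X1_minus_i * f) = (X1_minus_i * conj2 X1_minus_i) * (f * conj2 f)"
      "(?X * f) * conj2 (?X * f) = (?X * ?X) * (f * conj2 f)"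
      by (simp_all only: L.star_mult X mult_ac)
    ultimately have "L ((X1_minus_i * f) * conj2 (X1_minus_i * f)) = L ((?X * f) * conj2 (?X * f)) + L (f * conj2 f)"
      by (simp only: distrib_right L.add mult_1)
    then show "(L.nrm f)\<^sup>2 \<le> (L.nrm (X1_minus_i * f))\<^sup>2" unfolding L.nrm_sq using L.pos_Re[of "?X * f"] by simp
  qed simp
  define app where "app f h \<longleftrightarrow> (\<lambda>n. L.nrm (X1_minus_i * h n - f)) \<longlonglongrightarrow> 0" for f and h :: "nat \<Rightarrow> complex poly poly"
  have appI: "app f h" if "e \<longlonglongrightarrow> 0" "\<And>n. L.nrm (X1_minus_i * h n - f) \<le> e n" for f h e
    unfolding app_def by (rule Lim_null_comparison[OF _ that(1)]) (use that(2) in simp)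
  have "\<exists>h. \<forall>n. W.nrm (X1_minus_i * h n - f) < 1 / real (Suc n)" for f
    using dense unfolding resolvent_dense_def by (intro choice) auto
  then obtain R where R: "\<And>f n. W.nrm (X1_minus_i * R f n - f) < 1 / real (Suc n)" by metis
  have lim_inv: "(\<lambda>n. 1 / real (Suc n)) \<longlonglongrightarrow> 0" by real_asymp
  have app_R: "app f (R f)" for f
    by (rule appI[OF lim_inv]) (use L_le_W R in \<open>meson le_less_trans less_imp_le\<close>)
  have app_X2: "app (X2 * f) (\<lambda>n. X2 * R f n)" for f
  proof (rule appI[OF lim_inv])
    fix n
    have "L.nrm (X1_minus_i * (X2 * R f n) - X2 * f) = L.nrm (X2 * (X1_minus_i * R f n - f))" by (simp add: algebra_simps)
    also have "\<dots> \<le> 1 / real (Suc n)" using X2_le_W R by (meson le_less_trans less_imp_le)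
    finally show "L.nrm (X1_minus_i * (X2 * R f n) - X2 * f) \<le> 1 / real (Suc n)" .
  qed
  have app_X1_minus_i: "app (X1_minus_i * f) (\<lambda>_. f)" for f by (simp add: app_def)
  have app_add: "app (f + g) (\<lambda>n. h n + k n)" if "app f h" "app g k" for f g h k
  proof (rule appI)
    show "(\<lambda>n. L.nrm (X1_minus_i * h n - f) + L.nrm (X1_minus_i * k n - g)) \<longlonglongrightarrow> 0"
      using tendsto_add[OF that[unfolded app_def]] by simp
    show "L.nrm (X1_minus_i * (h n + k n) - (f + g)) \<le> L.nrm (X1_minus_i * h n - f) + L.nrm (X1_minus_i * k n - g)" for n
      using L.nrm_triangle[of "X1_minus_i * h n - f" "X1_minus_i * k n - g"] by (simp add: algebra_simps)
  qed
  have app_scale: "app (const2 c * f) (\<lambda>n. const2 c * h n)" if "app f h" for c f h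
  proof -
    have "X1_minus_i * (const2 c * h n) - const2 c * f = const2 c * (X1_minus_i * h n - f)" for n by (simp only: algebra_simps)
    then have "L.nrm (X1_minus_i * (const2 c * h n) - const2 c * f) = cmod c * L.nrm (X1_minus_i * h n - f)" for n
      by (simp only: L.nrm_scale)
    then show ?thesis using tendsto_mult_right[of _ 0 _ "cmod c"] that unfolding app_def by (simp add: tendsto_mult_right_zero)
  qed
  have bound: "L.nrm h \<le> L.nrm f + L.nrm (X1_minus_i * h - f)" for h f
    using le_X1_minus_i[of h] L.nrm_triangle[of f "X1_minus_i * h - f"] by simp
  have diff_bound: "L.nrm (h - h') \<le> L.nrm (X1_minus_i * h - f) + L.nrm (X1_minus_i * h' - f)" for h h' f
    using le_X1_minus_i[of "h - h'"] L.nrm_triangle_diff[of "X1_minus_i * h - f" "X1_minus_i * h' - f"] by (simp add: algebra_simps)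
  \<comment> \<open>One estimate serves both for convergence and for independence of the chosen sequences.\<close>
  have est: "cmod (L (h * conj2 k) - L (h' * conj2 k')) \<le>
      (L.nrm (X1_minus_i * h - f) + L.nrm (X1_minus_i * h' - f)) * (L.nrm g + L.nrm (X1_minus_i * k - g)) +
      (L.nrm f + L.nrm (X1_minus_i * h' - f)) * (L.nrm (X1_minus_i * k - g) + L.nrm (X1_minus_i * k' - g))" for h k h' k' f g
  proof -
    have "L (h * conj2 k) - L (h' * conj2 k') = L ((h - h') * conj2 k) + L (h' * conj2 (k - k'))"
      by (simp add: L.star_diff algebra_simps flip: L.diff L.add)
    also have "cmod \<dots> \<le> L.nrm (h - h') * L.nrm k + L.nrm h' * L.nrm (k - k')"
      by (intro norm_triangle_mono L.Cauchy_Schwarz)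
    also have "\<dots> \<le> (L.nrm (X1_minus_i * h - f) + L.nrm (X1_minus_i * h' - f)) * (L.nrm g + L.nrm (X1_minus_i * k - g)) +
      (L.nrm f + L.nrm (X1_minus_i * h' - f)) * (L.nrm (X1_minus_i * k - g) + L.nrm (X1_minus_i * k' - g))"
      by (intro add_mono mult_mono bound diff_bound) auto
    finally show ?thesis .
  qed
  have bdd: "\<exists>C. \<forall>n. L.nrm (X1_minus_i * h n - f) \<le> C" if "app f h" for f h
    using convergent_imp_Bseq[OF convergentI[OF that[unfolded app_def]]] unfolding Bseq_def by force
  have conv: "convergent (\<lambda>n. L (h n * conj2 (k n)))" if h: "app f h" and k: "app g k" for f g h k
  proof -
    obtain C where C: "\<And>n. L.nrm (X1_minus_i * h n - f) \<le> C" using bdd[OF h] by blast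
    obtain C' where C': "\<And>n. L.nrm (X1_minus_i * k n - g) \<le> C'" using bdd[OF k] by blast
    define e where "e n = L.nrm (X1_minus_i * h n - f) * (L.nrm g + C') + (L.nrm f + C) * L.nrm (X1_minus_i * k n - g)" for n
    have C0: "C \<ge> 0" "C' \<ge> 0" using C[of 0] C'[of 0] L.nrm_nonneg order_trans by blast+
    have "Cauchy (\<lambda>n. L (h n * conj2 (k n)))"
    proof (rule Cauchy_if_dist_le_add)
      show "e \<longlonglongrightarrow> 0" unfolding e_def using h k unfolding app_def
        by (intro tendsto_add_zero tendsto_mult_left_zero tendsto_mult_right_zero)
      fix m n
      have "cmod (L (h m * conj2 (k m)) - L (h n * conj2 (k n))) \<le>
        (L.nrm (X1_minus_i * h m - f) + L.nrm (X1_minus_i * h n - f)) * (L.nrm g + L.nrm (X1_minus_i * k m - g)) +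
        (L.nrm f + L.nrm (X1_minus_i * h n - f)) * (L.nrm (X1_minus_i * k m - g) + L.nrm (X1_minus_i * k n - g))" by (rule est)
      also have "\<dots> \<le> (L.nrm (X1_minus_i * h m - f) + L.nrm (X1_minus_i * h n - f)) * (L.nrm g + C') +
        (L.nrm f + C) * (L.nrm (X1_minus_i * k m - g) + L.nrm (X1_minus_i * k n - g))"
        by (intro add_mono mult_mono) (use C C' C0 in auto)
      finally show "dist (L (h m * conj2 (k m))) (L (h n * conj2 (k n))) \<le> e m + e n"
        by (simp add: dist_norm e_def algebra_simps)
    qed
    then show ?thesis by (rule Cauchy_convergent)
  qed
  define B where "B f g = lim (\<lambda>n. L (R f n * conj2 (R g n)))" for f g
  have B: "(\<lambda>n. L (h n * conj2 (k n))) \<longlonglongrightarrow> B f g" if h: "app f h" and k: "app g k" for f g h k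
  proof -
    have 1: "(\<lambda>n. L (R f n * conj2 (R g n))) \<longlonglongrightarrow> B f g"
      unfolding B_def using conv[OF app_R app_R] by (simp add: convergent_LIMSEQ_iff)
    define e where "e n = (L.nrm (X1_minus_i * h n - f) + L.nrm (X1_minus_i * R f n - f)) * (L.nrm g + L.nrm (X1_minus_i * k n - g)) +
      (L.nrm f + L.nrm (X1_minus_i * R f n - f)) * (L.nrm (X1_minus_i * k n - g) + L.nrm (X1_minus_i * R g n - g))" for n
    have "e \<longlonglongrightarrow> (0 + 0) * (L.nrm g + 0) + (L.nrm f + 0) * (0 + 0)"
      unfolding e_def using h k app_R[of f] app_R[of g] unfolding app_def by (intro tendsto_intros)
    then have lim: "e \<longlonglongrightarrow> 0" by simp
    have "\<forall>n. norm (L (h n * conj2 (k n)) - L (R f n * conj2 (R g n))) \<le> e n"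
      unfolding e_def by (intro allI est)
    from Lim_null_comparison[OF always_eventually[OF this] lim]
    have "(\<lambda>n. L (h n * conj2 (k n)) - L (R f n * conj2 (R g n))) \<longlonglongrightarrow> 0" .
    from tendsto_add[OF this 1] show ?thesis by simp
  qed
  have B_eqI: "B f g = b" if "app f h" "app g k" "(\<lambda>n. L (h n * conj2 (k n))) \<longlonglongrightarrow> b" for f g h k b
    using B[OF that(1,2)] that(3) by (rule LIMSEQ_unique)
  have B_cnj: "B g f = cnj (B f g)" for f g
  proof (rule B_eqI[OF app_R app_R])
    show "(\<lambda>n. L (R g n * conj2 (R f n))) \<longlonglongrightarrow> cnj (B f g)"
      unfolding L.hermitian_form[of "R g _"] by (intro tendsto_cnj B app_R)
  qed
  have B_add: "B (f + f') g = B f g + B f' g" for f f' g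
  proof (rule B_eqI[OF app_add[OF app_R app_R] app_R])
    show "(\<lambda>n. L ((R f n + R f' n) * conj2 (R g n))) \<longlonglongrightarrow> B f g + B f' g"
      unfolding distrib_right L.add by (intro tendsto_add B app_R)
  qed
  have B_add': "B f (g + g') = B f g + B f g'" for f g g'
    using B_add[of g g' f] B_cnj by (metis complex_cnj_add)
  have B_scale: "B (const2 c * f) g = c * B f g" for c f g
  proof (rule B_eqI[OF app_scale[OF app_R] app_R])
    show "(\<lambda>n. L (const2 c * R f n * conj2 (R g n))) \<longlonglongrightarrow> c * B f g"
      unfolding mult.assoc L.scale by (intro tendsto_mult_left B app_R)
  qed
  have B_scale': "B f (const2 c * g) = cnj c * B f g" for c f g
    using B_scale[of c g f] B_cnj by (metis complex_cnj_mult)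
  have B_X1_minus_i: "B (X1_minus_i * f) (X1_minus_i * g) = L (f * conj2 g)" for f g
    by (rule B_eqI[OF app_X1_minus_i app_X1_minus_i]) simp
  \<comment> \<open>Multiplication is symmetric for the limit form, one generator at a time.\<close>
  have B_move: "\<forall>f g. B (s * f) g = B f (conj2 s * g)" for s
  proof (induction s rule: poly2_induct)
    case (const c)
    then show ?case by (simp only: B_scale conj2_const2 B_scale' complex_cnj_cnj) simp
  next
    case X1
    show ?case
    proof (intro allI)
      fix f g
      let ?h = "R f" and ?k = "R g"
      have "app (X1_minus_i * g + const2 (2 * \<i>) * g) (\<lambda>n. g + const2 (2 * \<i>) * ?k n)"
        by (intro app_add app_X1_minus_i app_scale app_R)
      then have app': "app (conj2 X1_minus_i * g) (\<lambda>n. g + const2 (2 * \<i>) * ?k n)"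
        by (simp only: conj2_X1_minus_i distrib_right)
      have 1: "(\<lambda>n. L (f * conj2 (?k n))) \<longlonglongrightarrow> B (X1_minus_i * f) g" by (rule B[OF app_X1_minus_i app_R])
      have 2: "(\<lambda>n. L (?h n * conj2 (g + const2 (2 * \<i>) * ?k n)) - L (f * conj2 (?k n))) \<longlonglongrightarrow> 0"
      proof (rule Lim_null_comparison[OF always_eventually])
        show "(\<lambda>n. (L.nrm f + L.nrm (X1_minus_i * ?h n - f)) * L.nrm (X1_minus_i * ?k n - g) +
            L.nrm (X1_minus_i * ?h n - f) * (L.nrm g + L.nrm (X1_minus_i * ?k n - g))) \<longlonglongrightarrow> 0"
        proof -
          have "(\<lambda>n. (L.nrm f + L.nrm (X1_minus_i * ?h n - f)) * L.nrm (X1_minus_i * ?k n - g) +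
              L.nrm (X1_minus_i * ?h n - f) * (L.nrm g + L.nrm (X1_minus_i * ?k n - g)))
              \<longlonglongrightarrow> (L.nrm f + 0) * 0 + 0 * (L.nrm g + 0)"
            using app_R[of f] app_R[of g] unfolding app_def by (intro tendsto_intros)
          then show ?thesis by simp
        qed
        show "\<forall>n. norm (L (?h n * conj2 (g + const2 (2 * \<i>) * ?k n)) - L (f * conj2 (?k n))) \<le>
          (L.nrm f + L.nrm (X1_minus_i * ?h n - f)) * L.nrm (X1_minus_i * ?k n - g) +
            L.nrm (X1_minus_i * ?h n - f) * (L.nrm g + L.nrm (X1_minus_i * ?k n - g))"
        proof
          fix n
          have "?h n * conj2 (g - X1_minus_i * ?k n) + (X1_minus_i * ?h n - f) * conj2 (?k n)
            = ?h n * conj2 g + (X1_minus_i * conj2 (?k n) - conj2 X1_minus_i * conj2 (?k n)) * ?h n - f * conj2 (?k n)"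
            by (simp only: L.star_diff L.star_mult algebra_simps)
          also have "X1_minus_i * conj2 (?k n) - conj2 X1_minus_i * conj2 (?k n) = conj2 (const2 (2 * \<i>) * ?k n)"
            unfolding L.star_mult conj2_X1_minus_i conj2_const2 by (simp add: algebra_simps flip: smult_minus_left)
          finally have eq: "?h n * conj2 (g + const2 (2 * \<i>) * ?k n) - f * conj2 (?k n) =
             ?h n * conj2 (g - X1_minus_i * ?k n) + (X1_minus_i * ?h n - f) * conj2 (?k n)"
            by (simp only: L.star_add algebra_simps)
          have "norm (L (?h n * conj2 (g + const2 (2 * \<i>) * ?k n)) - L (f * conj2 (?k n)))
            \<le> L.nrm (?h n) * L.nrm (g - X1_minus_i * ?k n) + L.nrm (X1_minus_i * ?h n - f) * L.nrm (?k n)"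
            unfolding L.diff[symmetric] eq L.add by (intro norm_triangle_mono L.Cauchy_Schwarz)
          also have "\<dots> \<le> (L.nrm f + L.nrm (X1_minus_i * ?h n - f)) * L.nrm (X1_minus_i * ?k n - g) +
            L.nrm (X1_minus_i * ?h n - f) * (L.nrm g + L.nrm (X1_minus_i * ?k n - g))"
            unfolding L.nrm_minus_commute[of g] by (intro add_mono mult_mono bound order_refl) auto
          finally show "norm (L (?h n * conj2 (g + const2 (2 * \<i>) * ?k n)) - L (f * conj2 (?k n))) \<le>
            (L.nrm f + L.nrm (X1_minus_i * ?h n - f)) * L.nrm (X1_minus_i * ?k n - g) +
            L.nrm (X1_minus_i * ?h n - f) * (L.nrm g + L.nrm (X1_minus_i * ?k n - g))" .
        qed
      qed
      from tendsto_add[OF 2 1]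
      have "(\<lambda>n. L (?h n * conj2 (g + const2 (2 * \<i>) * ?k n))) \<longlonglongrightarrow> B (X1_minus_i * f) g"
        by (simp only: diff_add_cancel add_0)
      then show "B (X1_minus_i * f) g = B f (conj2 X1_minus_i * g)"
        by (rule B_eqI[OF app_R app', symmetric])
    qed
  next
    case X2
    show ?case
    proof (intro allI)
      fix f g
      have "(\<lambda>n. L (R f n * conj2 (X2 * R g n))) \<longlonglongrightarrow> B f (X2 * g)"
        by (rule B[OF app_R app_X2])
      then have "(\<lambda>n. L (X2 * R f n * conj2 (R g n))) \<longlonglongrightarrow> B f (X2 * g)"
        by (simp only: L.star_mult conj2_X2 mult_ac)
      then show "B (X2 * f) g = B f (conj2 X2 * g)"
        unfolding conj2_X2 by (rule B_eqI[OF app_X2 app_R])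
    qed
  next
    case (add s t)
    then show ?case by (simp only: distrib_right L.star_add B_add B_add') simp
  next
    case (mult s t)
    then show ?case by (simp only: L.star_mult mult.assoc) (simp add: mult.left_commute)
  qed
  define L' where "L' f = B f 1" for f
  have L'_B: "L' (f * conj2 g) = B f g" for f g
    using B_move[rule_format, of "conj2 g" f 1] by (simp add: L'_def mult.commute)
  have B_pos: "B f f \<in> \<real>\<^sub>\<ge>\<^sub>0" for f
    by (rule Lim_in_closed_set[OF closed_nonneg_Reals_complex _ _ B[OF app_R app_R]]) (simp_all add: L.pos)
  have B_le: "Re (B f f) \<le> Re (L (f * conj2 f))" for f
  proof (rule LIMSEQ_le)
    show "(\<lambda>n. Re (L (R f n * conj2 (R f n)))) \<longlonglongrightarrow> Re (B f f)" by (intro tendsto_Re B app_R)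
    have "(\<lambda>n. (L.nrm f + L.nrm (X1_minus_i * R f n - f))\<^sup>2) \<longlonglongrightarrow> (L.nrm f + 0)\<^sup>2"
      using app_R[of f] unfolding app_def by (intro tendsto_intros)
    then show "(\<lambda>n. (L.nrm f + L.nrm (X1_minus_i * R f n - f))\<^sup>2) \<longlonglongrightarrow> Re (L (f * conj2 f))" by (simp add: L.nrm_sq)
    show "\<exists>N. \<forall>n\<ge>N. Re (L (R f n * conj2 (R f n))) \<le> (L.nrm f + L.nrm (X1_minus_i * R f n - f))\<^sup>2"
      unfolding L.nrm_sq[symmetric] by (intro exI[of _ 0] allI impI power_mono bound) simp
  qed
  have pos': "positive2 L'"
  proof (rule positive2I)
    show "L' (p * conj2 p) \<in> \<real>\<^sub>\<ge>\<^sub>0" for p unfolding L'_B by (rule B_pos)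
  qed (simp_all only: L'_def B_add B_scale)
  moreover have "resolvent_dense L'"
    unfolding resolvent_dense_def
  proof (intro allI impI)
    interpret W': star_functional const2 conj2 "weighted L'" by (rule positive2_weighted[OF pos'])
    have le: "W'.nrm f \<le> W.nrm f" for f
      unfolding W'.nrm_def W.nrm_def weighted_square L'_B by (intro real_sqrt_le_mono B_le)
    fix f and d :: real assume "d > 0"
    then obtain h where "W.nrm (X1_minus_i * h - f) < d" using dense unfolding resolvent_dense_def by blast
    then show "\<exists>h. W'.nrm (X1_minus_i * h - f) < d" using le le_less_trans by blast
  qed
  moreover have "L' (X1_minus_i * conj2 X1_minus_i * f) = L f" for f
  proof -
    have "L' (X1_minus_i * conj2 X1_minus_i * f) = L' ((X1_minus_i * f) * conj2 (X1_minus_i * 1))" by (simp add: mult_ac)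
    also have "\<dots> = L (f * conj2 1)" unfolding L'_B by (rule B_X1_minus_i)
    finally show ?thesis by simp
  qed
  ultimately show ?thesis by blast
qed

corollary adjoin_resolvent_power:
  assumes "positive2 L" "resolvent_dense L"
  shows "\<exists>L'. positive2 L' \<and> resolvent_dense L' \<and> (\<forall>f. L' ((X1_minus_i * conj2 X1_minus_i) ^ n * f) = L f)"
proof (induction n)
  case 0
  then show ?case using assms by auto
next
  case (Suc n)
  then obtain L' where L': "positive2 L'" "resolvent_dense L'" "\<And>f. L' ((X1_minus_i * conj2 X1_minus_i) ^ n * f) = L f" by blast
  from adjoin_resolvent[OF L'(1,2)] obtain L'' where L'': "positive2 L''" "resolvent_dense L''"
    "\<And>f. L'' (X1_minus_i * conj2 X1_minus_i * f) = L' f" by blast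
  have "L'' ((X1_minus_i * conj2 X1_minus_i) ^ Suc n * f) = L f" for f
    using L''(3)[of "(X1_minus_i * conj2 X1_minus_i) ^ n * f"] L'(3)[of f] by (simp add: mult_ac)
  with L'' show ?case by blast
qed

section \<open>Fejer kernels\<close>

lemma conj1_sum: "conj1 (\<Sum>i\<in>I. f i) = (\<Sum>i\<in>I. conj1 (f i))"
  by (induction I rule: infinite_finite_induct) (simp_all add: conj1_add)

lemma smult_sum_right: "smult c (\<Sum>i\<in>I. f i) = (\<Sum>i\<in>I. smult c (f i))"
  by (induction I rule: infinite_finite_induct) (simp_all add: smult_add_right)

lemma conj1_power: "conj1 (p ^ n) = conj1 p ^ n"
  by (induction n) (simp_all add: conj1_mult)

text \<open>
The polynomials $1+\mathrm{i}x$ and $1-\mathrm{i}x$: their quotient is the Cayley transform of the line onto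
the unit circle without $-1$, and their product is $1+x^2$.
\<close>

definition cayley :: "complex poly" where "cayley = [:1, \<i>:]"
definition cayley' :: "complex poly" where "cayley' = [:1, -\<i>:]"

lemma conj1_cayley [simp]: "conj1 cayley = cayley'" "conj1 cayley' = cayley"
  by (simp_all add: cayley_def cayley'_def map_poly_pCons)

lemma X1_minus_i_mult_conj2: "X1_minus_i * conj2 X1_minus_i = x1_poly (cayley * cayley')"
  by (simp add: X1_minus_i_def x1_poly_def cayley_def cayley'_def map_poly_pCons conj2_def)

text \<open>
Forms of degree $d$ in the two factors. Divided by $(1+x^2)^{d/2}$, for even $d$, they are the trigonometric
polynomials on the circle.
\<close>

definition homogeneous :: "nat \<Rightarrow> complex poly \<Rightarrow> bool" where
  "homogeneous d p \<longleftrightarrow> (\<exists>\<beta>. p = (\<Sum>r\<le>d. smult (\<beta> r) (cayley ^ r * cayley' ^ (d - r))))"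

lemma homogeneous_add: "homogeneous d p \<Longrightarrow> homogeneous d q \<Longrightarrow> homogeneous d (p + q)"
  unfolding homogeneous_def
proof (elim exE)
  fix \<beta> \<gamma> assume "p = (\<Sum>r\<le>d. smult (\<beta> r) (cayley ^ r * cayley' ^ (d - r)))"
    "q = (\<Sum>r\<le>d. smult (\<gamma> r) (cayley ^ r * cayley' ^ (d - r)))"
  then show "\<exists>\<beta>. p + q = (\<Sum>r\<le>d. smult (\<beta> r) (cayley ^ r * cayley' ^ (d - r)))"
    by (intro exI[of _ "\<lambda>r. \<beta> r + \<gamma> r"]) (simp add: smult_add_left sum.distrib)
qed

lemma homogeneous_smult: "homogeneous d p \<Longrightarrow> homogeneous d (smult c p)"
  unfolding homogeneous_def
proof (elim exE)
  fix \<beta> assume "p = (\<Sum>r\<le>d. smult (\<beta> r) (cayley ^ r * cayley' ^ (d - r)))"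
  then show "\<exists>\<beta>. smult c p = (\<Sum>r\<le>d. smult (\<beta> r) (cayley ^ r * cayley' ^ (d - r)))"
    by (intro exI[of _ "\<lambda>r. c * \<beta> r"]) (simp add: smult_sum_right)
qed

lemma homogeneous_cayley_mult: "homogeneous d p \<Longrightarrow> homogeneous (Suc d) (cayley * p)"
  unfolding homogeneous_def
proof (elim exE)
  fix \<beta> assume "p = (\<Sum>r\<le>d. smult (\<beta> r) (cayley ^ r * cayley' ^ (d - r)))"
  then have "cayley * p = (\<Sum>r\<le>Suc d. smult (case r of 0 \<Rightarrow> 0 | Suc r \<Rightarrow> \<beta> r) (cayley ^ r * cayley' ^ (Suc d - r)))"
    by (simp add: sum.atMost_Suc_shift sum_distrib_left mult.assoc del: sum.atMost_Suc)
  then show "\<exists>\<beta>. cayley * p = (\<Sum>r\<le>Suc d. smult (\<beta> r) (cayley ^ r * cayley' ^ (Suc d - r)))" by blast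
qed

lemma homogeneous_cayley'_mult: "homogeneous d p \<Longrightarrow> homogeneous (Suc d) (cayley' * p)"
  unfolding homogeneous_def
proof (elim exE)
  fix \<beta> assume p: "p = (\<Sum>r\<le>d. smult (\<beta> r) (cayley ^ r * cayley' ^ (d - r)))"
  have "cayley' * p = (\<Sum>r\<le>d. smult (if r = Suc d then 0 else \<beta> r) (cayley ^ r * cayley' ^ (Suc d - r)))"
    unfolding p sum_distrib_left by (rule sum.cong) (auto simp: Suc_diff_le mult_ac)
  then have "cayley' * p = (\<Sum>r\<le>Suc d. smult (if r = Suc d then 0 else \<beta> r) (cayley ^ r * cayley' ^ (Suc d - r)))"
    by simp
  then show "\<exists>\<beta>. cayley' * p = (\<Sum>r\<le>Suc d. smult (\<beta> r) (cayley ^ r * cayley' ^ (Suc d - r)))"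
    by (intro exI[of _ "\<lambda>r. if r = Suc d then 0 else \<beta> r"])
qed

text \<open>
Both $1$ and $x$ are linear combinations of the two factors.
\<close>

lemma homogeneous_Suc:
  assumes "homogeneous d p"
  shows "homogeneous (Suc d) p" "homogeneous (Suc d) (pCons 0 p)"
proof -
  have "p = smult (1/2) (cayley * p) + smult (1/2) (cayley' * p)"
    "pCons 0 p = smult (-\<i>/2) (cayley * p) + smult (\<i>/2) (cayley' * p)"
    by (simp_all add: cayley_def cayley'_def smult_add_right algebra_simps flip: smult_add_left)
  then show "homogeneous (Suc d) p" "homogeneous (Suc d) (pCons 0 p)"
    using homogeneous_add homogeneous_smult homogeneous_cayley_mult[OF assms] homogeneous_cayley'_mult[OF assms] by metis+
qed

lemma homogeneous_monom: "m \<le> d \<Longrightarrow> homogeneous d (monom 1 m)"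
proof (induction d arbitrary: m)
  case 0
  then show ?case unfolding homogeneous_def by (intro exI[of _ "\<lambda>_. 1"]) simp
next
  case (Suc d)
  show ?case
  proof (cases m)
    case 0
    then show ?thesis using Suc.IH[of 0] homogeneous_Suc(1) by simp
  next
    case (Suc k)
    then show ?thesis using Suc.IH[of k] Suc.prems homogeneous_Suc(2) by (simp add: monom_Suc)
  qed
qed

text \<open>
The nodes are the roots of $z^M=-1$ and not of $z^M=1$: for even $M$ they avoid $-1$, the image of
infinity under the Cayley transform.
\<close>

definition unit_node :: "nat \<Rightarrow> nat \<Rightarrow> complex" where
  "unit_node M j = cis (2 * pi * (real j + 1 / 2) / real M)"

lemma norm_unit_node: "unit_node M j * cnj (unit_node M j) = 1"
  by (simp add: unit_node_def cis_cnj cis_mult)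

lemma unit_node_ne_minus_one:
  assumes "even M" "M > 0"
  shows "unit_node M j \<noteq> - 1"
proof
  assume "unit_node M j = - 1"
  then have "unit_node M j ^ M = 1" using assms by simp
  moreover have "real M * (2 * pi * (real j + 1 / 2) / real M) = pi + 2 * pi * real j"
    using assms by (simp add: field_simps)
  then have "unit_node M j ^ M = cis (pi + 2 * pi * real j)"
    unfolding unit_node_def Complex.DeMoivre by (rule arg_cong)
  moreover have "\<dots> = - 1" unfolding cis_mult[symmetric] by (simp add: cis_multiple_2pi)
  ultimately show False by simp
qed

lemma sum_unit_nodes:
  assumes "a < M" "b < M"
  shows "(\<Sum>j<M. unit_node M j ^ a * cnj (unit_node M j) ^ b) = (if a = b then of_nat M else 0)"
proof (cases "a = b")
  case True
  have "unit_node M j ^ a * cnj (unit_node M j) ^ a = 1" for j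
    by (simp add: norm_unit_node flip: power_mult_distrib)
  then show ?thesis using True by simp
next
  case False
  define \<alpha> where "\<alpha> = 2 * pi * (real a - real b) / real M"
  have M: "M > 0" using assms by simp
  have "unit_node M j ^ a * cnj (unit_node M j) ^ b = cis (\<alpha> / 2) * cis \<alpha> ^ j" for j
  proof -
    have "unit_node M j ^ a * cnj (unit_node M j) ^ b =
      cis (real a * (2 * pi * (real j + 1 / 2) / real M) + real b * - (2 * pi * (real j + 1 / 2) / real M))"
      unfolding unit_node_def cis_cnj Complex.DeMoivre cis_mult ..
    also have "real a * (2 * pi * (real j + 1 / 2) / real M) + real b * - (2 * pi * (real j + 1 / 2) / real M)
      = \<alpha> / 2 + real j * \<alpha>"
      using M by (simp add: \<alpha>_def field_simps)
    finally show ?thesis by (simp add: Complex.DeMoivre cis_mult)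
  qed
  then have "(\<Sum>j<M. unit_node M j ^ a * cnj (unit_node M j) ^ b) = cis (\<alpha> / 2) * (\<Sum>j<M. cis \<alpha> ^ j)"
    by (simp add: sum_distrib_left)
  also have "(\<Sum>j<M. cis \<alpha> ^ j) = 0"
  proof -
    have "cis \<alpha> \<noteq> 1"
    proof
      assume "cis \<alpha> = 1"
      then have "cos \<alpha> = 1" by (metis cis.sel(1) one_complex.sel(1))
      then obtain n :: int where "\<alpha> = of_int n * 2 * pi" using cos_one_2pi_int by auto
      then have "2 * pi * ((real a - real b) / real M - of_int n) = 0" by (simp add: \<alpha>_def algebra_simps)
      then have "(real a - real b) / real M = of_int n" by simp
      then have "real a - real b = of_int n * real M" using M by (simp add: field_simps)
      then have n: "int a - int b = n * int M" by (metis of_int_diff of_int_eq_iff of_int_mult of_int_of_nat_eq)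
      have "\<bar>int a - int b\<bar> < int M" using assms by linarith
      then have "\<bar>n\<bar> * int M < 1 * int M" unfolding n abs_mult by simp
      then have "n = 0" using M by (simp add: mult_less_cancel_right)
      then show False using n False by simp
    qed
    moreover have "cis \<alpha> ^ M = 1"
    proof -
      have "cis \<alpha> ^ M = cis (2 * pi * of_int (int a - int b))"
        unfolding Complex.DeMoivre using M by (simp add: \<alpha>_def)
      then show ?thesis by (simp only: cis_multiple_2pi Ints_of_int)
    qed
    ultimately show ?thesis by (simp add: geometric_sum)
  qed
  finally show ?thesis using False by simp
qed

text \<open>
The point $t$ of the line with Cayley transform $z$ is obtained from the tangent half-angle
formula.
\<close>

lemma cayley_node:
  assumes "z * cnj z = 1" "z \<noteq> - 1"
  defines "t \<equiv> Im z / (1 + Re z)"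
  shows "poly cayley (complex_of_real t) = z * poly cayley' (complex_of_real t)"
    and "(poly cayley' (complex_of_real t))\<^sup>2 = cnj z * complex_of_real (1 + t\<^sup>2)"
proof -
  have norm: "(Re z)\<^sup>2 + (Im z)\<^sup>2 = 1"
    using assms(1) by (simp add: complex_eq_iff power2_eq_square)
  have ne: "1 + Re z \<noteq> 0"
  proof
    assume "1 + Re z = 0"
    then have r: "Re z = -1" by simp
    then have "Im z = 0" using norm by simp
    then show False using assms(2) r by (simp add: complex_eq_iff)
  qed
  have "Im z * Im z = (1 - Re z) * (1 + Re z)" using norm by (simp add: power2_eq_square algebra_simps)
  then have t: "t * Im z = 1 - Re z" "t * (1 + Re z) = Im z" using ne by (simp_all add: t_def field_simps)
  have "1 + \<i> * complex_of_real t = z * (1 - \<i> * complex_of_real t)"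
    using t by (simp add: complex_eq_iff algebra_simps)
  then show *: "poly cayley (complex_of_real t) = z * poly cayley' (complex_of_real t)"
    by (simp add: cayley_def cayley'_def mult.commute)
  have "poly cayley (complex_of_real t) * poly cayley' (complex_of_real t) = complex_of_real (1 + t\<^sup>2)"
    by (simp add: cayley_def cayley'_def complex_eq_iff power2_eq_square)
  then have "cnj z * complex_of_real (1 + t\<^sup>2) = (z * cnj z) * (poly cayley' (complex_of_real t))\<^sup>2"
    unfolding * by (simp add: power2_eq_square mult_ac)
  then show "(poly cayley' (complex_of_real t))\<^sup>2 = cnj z * complex_of_real (1 + t\<^sup>2)"
    using assms(1) by simp
qed

text \<open>
Up to the factor $(1-\mathrm{i}x)^n$ this is the geometric sum $\sum_{k\le n}(u\overline{z})^k$ in the Cayley variable $u$;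
the square of its modulus is a multiple of the Fejer kernel centred at $z$.
\<close>

definition fejer :: "nat \<Rightarrow> complex \<Rightarrow> complex poly" where
  "fejer n z = (\<Sum>k\<le>n. smult (cnj z ^ k) (cayley ^ k * cayley' ^ (n - k)))"

lemma fejer_square:
  "fejer n z * conj1 (fejer n z) =
    (\<Sum>k\<le>n. \<Sum>l\<le>n. smult (z ^ l * cnj z ^ k) (cayley ^ (k + (n - l)) * cayley' ^ ((n - k) + l)))"
proof -
  have "conj1 (fejer n z) = (\<Sum>l\<le>n. smult (z ^ l) (cayley' ^ l * cayley ^ (n - l)))"
    by (simp add: fejer_def conj1_sum map_poly_smult conj1_mult conj1_power)
  then have "fejer n z * conj1 (fejer n z) = (\<Sum>k\<le>n. \<Sum>l\<le>n.
      smult (cnj z ^ k) (cayley ^ k * cayley' ^ (n - k)) * smult (z ^ l) (cayley' ^ l * cayley ^ (n - l)))"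
    by (simp only: fejer_def sum_product)
  also have "\<dots> = (\<Sum>k\<le>n. \<Sum>l\<le>n. smult (z ^ l * cnj z ^ k) (cayley ^ (k + (n - l)) * cayley' ^ ((n - k) + l)))"
    by (intro sum.cong refl) (simp only: power_add mult_smult_left mult_smult_right smult_smult mult_ac)
  finally show ?thesis .
qed

text \<open>
The Cesaro weight $n+1-|r-K|$, kept as a count of index pairs because only the two bounds below
are used.
\<close>

definition fejer_count :: "nat \<Rightarrow> nat \<Rightarrow> nat \<Rightarrow> real" where
  "fejer_count n K r = (\<Sum>k\<le>n. \<Sum>l\<le>n. if r + l = K + k then 1 else 0)"

lemma fejer_count_bounds:
  assumes "r \<le> 2 * K" "2 * K \<le> n"
  shows "fejer_count n K r \<le> real (Suc n)" "real (Suc n) - 2 * real K \<le> fejer_count n K r"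
proof -
  have inner: "(\<Sum>l\<le>n. if r + l = K + k then 1 else 0 :: real) = (if r \<le> K + k \<and> K + k - r \<le> n then 1 else 0)" for k
  proof -
    have "(\<Sum>l\<le>n. if r + l = K + k then 1 else 0 :: real) = (\<Sum>l\<le>n. if l = K + k - r then (if r \<le> K + k then 1 else 0) else 0)"
      by (rule sum.cong) auto
    then show ?thesis by simp
  qed
  have "fejer_count n K r \<le> (\<Sum>k\<le>n. 1)" unfolding fejer_count_def inner by (rule sum_mono) simp
  then show "fejer_count n K r \<le> real (Suc n)" by simp
  have "real (Suc n) - 2 * real K = (\<Sum>k\<in>{K..n - K}. if r \<le> K + k \<and> K + k - r \<le> n then 1 else 0)"
  proof -
    have "(\<Sum>k\<in>{K..n - K}. if r \<le> K + k \<and> K + k - r \<le> n then 1 else 0 :: real) = (\<Sum>k\<in>{K..n - K}. 1)"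
      by (rule sum.cong) (use assms in auto)
    then show ?thesis using assms by (simp add: of_nat_diff)
  qed
  also have "\<dots> \<le> fejer_count n K r"
    unfolding fejer_count_def inner by (rule sum_mono2) auto
  finally show "real (Suc n) - 2 * real K \<le> fejer_count n K r" .
qed

text \<open>
Sampling a trigonometric polynomial at the nodes against Fejer kernels returns its Cesaro mean.
The nodes integrate all occurring frequencies exactly since $M$ exceeds them, so that every Fourier coefficient is
merely multiplied by its weight.
\<close>

theorem sum_fejer_squares:
  assumes M: "2 * K + n < M" and n: "n = K + R"
  shows "(\<Sum>j<M. smult (\<Sum>r\<le>2 * K. \<beta> r * unit_node M j ^ r * cnj (unit_node M j) ^ K)
      (fejer n (unit_node M j) * conj1 (fejer n (unit_node M j)))) =
    (\<Sum>r\<le>2 * K. smult (of_nat M * complex_of_real (fejer_count n K r) * \<beta> r)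
      ((cayley * cayley') ^ R * (cayley ^ r * cayley' ^ (2 * K - r))))"
proof -
  define z where "z = unit_node M"
  define E where "E k l = cayley ^ (k + (n - l)) * cayley' ^ ((n - k) + l)" for k l
  define D where "D r = (cayley * cayley') ^ R * (cayley ^ r * cayley' ^ (2 * K - r))" for r
  have orth: "(\<Sum>j<M. z j ^ (r + l) * cnj (z j) ^ (K + k)) = (if r + l = K + k then of_nat M else 0)"
    if "r \<le> 2 * K" "k \<le> n" "l \<le> n" for r k l
    unfolding z_def by (rule sum_unit_nodes) (use that M in auto)
  have ED: "E k l = D r" if "r + l = K + k" "r \<le> 2 * K" "k \<le> n" "l \<le> n" for r k l
  proof -
    have "k + (n - l) = R + r" "(n - k) + l = R + (2 * K - r)" using that n by auto
    then show ?thesis by (simp add: E_def D_def power_add power_mult_distrib mult_ac)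
  qed
  have "(\<Sum>j<M. smult (\<Sum>r\<le>2 * K. \<beta> r * z j ^ r * cnj (z j) ^ K) (fejer n (z j) * conj1 (fejer n (z j)))) =
    (\<Sum>j<M. \<Sum>r\<le>2 * K. \<Sum>k\<le>n. \<Sum>l\<le>n. smult (\<beta> r * (z j ^ (r + l) * cnj (z j) ^ (K + k))) (E k l))"
    unfolding smult_sum unfolding fejer_square smult_sum_right smult_smult
    by (intro sum.cong refl) (simp only: E_def power_add mult_ac)
  also have "\<dots> = (\<Sum>r\<le>2 * K. \<Sum>k\<le>n. \<Sum>l\<le>n. \<Sum>j<M. smult (\<beta> r * (z j ^ (r + l) * cnj (z j) ^ (K + k))) (E k l))"
    by (rule trans[OF sum.swap], rule sum.cong[OF refl], rule trans[OF sum.swap], rule sum.cong[OF refl], rule sum.swap)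
  also have "\<dots> = (\<Sum>r\<le>2 * K. \<Sum>k\<le>n. \<Sum>l\<le>n. smult (\<beta> r * (\<Sum>j<M. z j ^ (r + l) * cnj (z j) ^ (K + k))) (E k l))"
    by (simp only: smult_sum sum_distrib_left)
  also have "\<dots> = (\<Sum>r\<le>2 * K. \<Sum>k\<le>n. \<Sum>l\<le>n. smult (complex_of_real (if r + l = K + k then 1 else 0) * (of_nat M * \<beta> r)) (D r))"
    by (intro sum.cong refl) (use orth ED in \<open>auto simp: mult.commute\<close>)
  also have "\<dots> = (\<Sum>r\<le>2 * K. smult (of_nat M * complex_of_real (fejer_count n K r) * \<beta> r) (D r))"
    unfolding fejer_count_def of_real_sum by (simp only: smult_sum[symmetric] sum_distrib_right[symmetric]) (simp add: mult_ac)
  finally show ?thesis unfolding z_def D_def .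
qed

section \<open>Atomic approximation of the two-dimensional functional\<close>

text \<open>
Substitution of $x_2$ for the variable of a one-variable polynomial.
\<close>

definition lift2 :: "complex poly \<Rightarrow> complex poly poly" where
  "lift2 = map_poly (\<lambda>c. [:c:])"

lemma lift2_add: "lift2 (p + q) = lift2 p + lift2 q"
  by (simp add: lift2_def map_poly_add_hom)

lemma lift2_mult: "lift2 (p * q) = lift2 p * lift2 q"
  by (simp add: lift2_def map_poly_mult_hom)

lemma lift2_smult: "lift2 (smult c p) = const2 c * lift2 p"
  by (simp add: lift2_def map_poly_smult)

lemma lift2_conj1: "lift2 (conj1 p) = conj2 (lift2 p)"
  by (induction p) (simp_all add: lift2_def conj2_def map_poly_pCons)

lemma lift2_monom: "lift2 (monom 1 n) = X2 ^ n"
proof -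
  have "lift2 (monom 1 n) = monom [:1:] n" unfolding lift2_def by (rule map_poly_monom) simp
  then show ?thesis by (simp add: X2_def monom_altdef flip: one_pCons)
qed

lemma x1_poly_mult: "x1_poly (p * q) = x1_poly p * x1_poly q"
  by (simp add: x1_poly_def)

lemma x1_poly_power: "x1_poly (p ^ n) = x1_poly p ^ n"
  by (induction n) (simp_all add: x1_poly_mult, simp add: x1_poly_def one_pCons)

lemma functional_x1_sum:
  assumes "positive2 L"
  shows "L (x1_poly (\<Sum>i\<in>I. smult (c i) (p i)) * f) = (\<Sum>i\<in>I. c i * L (x1_poly (p i) * f))"
proof -
  interpret star_functional const2 conj2 L by fact
  show ?thesis
  proof (induction I rule: infinite_finite_induct)
    case (insert i I)
    have "x1_poly (\<Sum>i\<in>insert i I. smult (c i) (p i)) * f =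
        const2 (c i) * (x1_poly (p i) * f) + x1_poly (\<Sum>i\<in>I. smult (c i) (p i)) * f"
      using insert(1,2) by (simp add: x1_poly_def smult_add_left)
    then show ?case by (simp only: add scale sum.insert[OF insert(1,2)] insert.IH)
  qed (simp_all add: x1_poly_def)
qed

lemma positive1_square_weight:
  assumes "positive2 L" "0 \<le> a"
  shows "positive1 (\<lambda>g. complex_of_real a * L (x1_poly (p * conj1 p) * lift2 g))"
proof -
  interpret star_functional const2 conj2 L by fact
  show ?thesis
  proof (rule positive1I)
    show "complex_of_real a * L (x1_poly (p * conj1 p) * lift2 (f + g)) =
        complex_of_real a * L (x1_poly (p * conj1 p) * lift2 f) + complex_of_real a * L (x1_poly (p * conj1 p) * lift2 g)"
      for f g by (simp only: lift2_add distrib_left add)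
    show "complex_of_real a * L (x1_poly (p * conj1 p) * lift2 (smult c g)) =
        c * (complex_of_real a * L (x1_poly (p * conj1 p) * lift2 g))" for c g
      unfolding lift2_smult mult.left_commute[of _ "const2 c"] scale by (simp only: mult_ac)
    fix g
    have "x1_poly (p * conj1 p) * lift2 (g * conj1 g) = (x1_poly p * lift2 g) * conj2 (x1_poly p * lift2 g)"
      by (simp only: x1_poly_mult lift2_mult lift2_conj1 star_mult conj2_x1_poly mult_ac)
    then show "complex_of_real a * L (x1_poly (p * conj1 p) * lift2 (g * conj1 g)) \<in> \<real>\<^sub>\<ge>\<^sub>0"
      using assms(2) pos[of "x1_poly p * lift2 g"] by (simp add: nonneg_Reals_mult_I)
  qed
qed

text \<open>
Atoms that coincide are merged.
\<close>

lemma atoms_of_indexed_family: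
  fixes wt :: "'i \<Rightarrow> real" and pt :: "'i \<Rightarrow> real \<times> real"
  assumes "finite I" "\<And>i. i \<in> I \<Longrightarrow> 0 \<le> wt i"
  shows "\<exists>A w. finite A \<and> (\<forall>z\<in>A. 0 \<le> w z) \<and> (\<forall>f :: _ \<Rightarrow> real. (\<Sum>z\<in>A. w z * f z) = (\<Sum>i\<in>I. wt i * f (pt i)))"
proof (intro exI conjI ballI allI)
  show "finite (pt ` I)" using assms by simp
  show "0 \<le> (\<Sum>i\<in>{i\<in>I. pt i = z}. wt i)" for z using assms by (auto intro: sum_nonneg)
  show "(\<Sum>z\<in>pt ` I. (\<Sum>i\<in>{i\<in>I. pt i = z}. wt i) * f z) = (\<Sum>i\<in>I. wt i * f (pt i))" for f :: "_ \<Rightarrow> real"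
    unfolding sum.image_gen[OF assms(1), of "\<lambda>i. wt i * f (pt i)" pt] sum_distrib_right
    by (intro sum.cong refl) auto
qed

text \<open>
Let $L'$ be the functional $f\mapsto L(f/(1+x_1^2)^R)$ and $n=K+R$. The $j$-th Fejer square with $L'$ gives the
positive functional \<open>l j\<close> on $C[x_2]$; its quadrature atoms are placed over the node $t_j$ with the extra
factor $(1+t_j^2)^{-K}$. This factor makes $x_1^m$ with $m\le K$ a trigonometric polynomial \<open>b m\<close>, so the
moments of the atomic measure are those of $L$ up to the Cesaro weights divided by $n+1$, which
tend to 1.
\<close>

theorem atomic_approximation:
  assumes pos: "positive2 L"
    and resolvents: "\<And>n. \<exists>L'. positive2 L' \<and> (\<forall>f. L' ((X1_minus_i * conj2 X1_minus_i) ^ n * f) = L f)"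
    and "e > 0"
  shows "\<exists>A w. finite A \<and> (\<forall>z\<in>A. 0 \<le> w z) \<and>
      (\<forall>m\<le>K. \<forall>n\<le>K. \<bar>(\<Sum>z\<in>A. w z * (fst z ^ m * snd z ^ n)) - Re (L (x1_poly (monom 1 m) * X2 ^ n))\<bar> < e)"
proof -
  define P where "P r = cayley ^ r * cayley' ^ (2 * K - r)" for r
  have "\<forall>m. \<exists>\<beta>. m \<le> K \<longrightarrow> monom 1 m = (\<Sum>r\<le>2 * K. smult (\<beta> r) (P r))"
    using homogeneous_monom[of _ "2 * K"] unfolding homogeneous_def P_def by auto
  then obtain \<beta> where \<beta>: "\<And>m. m \<le> K \<Longrightarrow> monom 1 m = (\<Sum>r\<le>2 * K. smult (\<beta> m r) (P r))" by metis
  define V where "V r n = L (x1_poly (P r) * X2 ^ n)" for r n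
  have LV: "L (x1_poly (monom 1 m) * X2 ^ n) = (\<Sum>r\<le>2 * K. \<beta> m r * V r n)" if "m \<le> K" for m n
    unfolding \<beta>[OF that] V_def by (rule functional_x1_sum[OF pos])
  define C where "C = (\<Sum>m\<le>K. \<Sum>n\<le>K. \<Sum>r\<le>2 * K. cmod (\<beta> m r * V r n))"
  have C: "(\<Sum>r\<le>2 * K. cmod (\<beta> m r * V r n)) \<le> C" if "m \<le> K" "n \<le> K" for m n
  proof -
    have "(\<Sum>r\<le>2 * K. cmod (\<beta> m r * V r n)) \<le> (\<Sum>n\<le>K. \<Sum>r\<le>2 * K. cmod (\<beta> m r * V r n))"
      by (rule member_le_sum) (use that in \<open>auto intro: sum_nonneg\<close>)
    also have "\<dots> \<le> C" unfolding C_def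
      by (rule member_le_sum[of m "{..K}" "\<lambda>m. \<Sum>n\<le>K. \<Sum>r\<le>2 * K. cmod (\<beta> m r * V r n)"])
        (use that in \<open>auto intro!: sum_nonneg\<close>)
    finally show ?thesis .
  qed
  obtain R0 :: nat where R0: "2 * real K * C / e < real R0" using reals_Archimedean2 by blast
  define R where "R = max R0 K"
  define n where "n = K + R"
  define M where "M = 2 * (2 * K + n + 1)"
  have M: "2 * K + n < M" "even M" "M > 0" by (simp_all add: M_def)
  have n: "2 * K \<le> n" by (simp add: n_def R_def)
  have small: "2 * real K * C / real (Suc n) < e"
  proof -
    have "2 * real K * C / e < real (Suc n)" using R0 by (simp add: n_def R_def)
    then show ?thesis using \<open>e > 0\<close> by (simp add: field_simps)
  qed
  obtain L' where pos': "positive2 L'" and L': "\<And>f. L' ((X1_minus_i * conj2 X1_minus_i) ^ R * f) = L f"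
    using resolvents by blast
  define z where "z = unit_node M"
  define F where "F j = fejer n (z j) * conj1 (fejer n (z j))" for j
  define a where "a = 1 / (real (Suc n) * real M)"
  have a: "a \<ge> 0" by (simp add: a_def)
  define l where "l j g = complex_of_real a * L' (x1_poly (F j) * lift2 g)" for j g
  have "positive1 (l j)" for j
    unfolding l_def F_def using positive1_square_weight[OF pos' a] .
  define quad where "quad j Z c \<longleftrightarrow> finite Z \<and> (\<forall>y\<in>Z. c y \<ge> 0) \<and>
    (\<forall>p. degree p < Suc K \<longrightarrow> l j p = (\<Sum>y\<in>Z. complex_of_real (c y) * poly p (complex_of_real y)))"
    for j and Z :: "real set" and c :: "real \<Rightarrow> real"
  have "\<exists>Z c. quad j Z c" for j
    unfolding quad_def by (rule gauss_quadrature) fact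
  then obtain Z c where "\<And>j. quad j (Z j) (c j)" by metis
  then have Z: "\<And>j. finite (Z j)" "\<And>j y. y \<in> Z j \<Longrightarrow> c j y \<ge> 0"
    "\<And>j p. degree p < Suc K \<Longrightarrow> l j p = (\<Sum>y\<in>Z j. complex_of_real (c j y) * poly p (complex_of_real y))"
    unfolding quad_def by blast+
  define t where "t j = Im (z j) / (1 + Re (z j))" for j
  have z: "z j * cnj (z j) = 1" "z j \<noteq> - 1" for j
    unfolding z_def by (rule norm_unit_node, rule unit_node_ne_minus_one[OF M(2,3)])
  define b where "b m j = (\<Sum>r\<le>2 * K. \<beta> m r * z j ^ r * cnj (z j) ^ K)" for m j
  have b: "complex_of_real (t j ^ m / (1 + (t j)\<^sup>2) ^ K) = b m j" if "m \<le> K" for m j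
  proof -
    have "complex_of_real (t j ^ m) = poly (\<Sum>r\<le>2 * K. smult (\<beta> m r) (P r)) (complex_of_real (t j))"
      unfolding \<beta>[OF that, symmetric] by (simp add: poly_monom)
    also have "\<dots> = (\<Sum>r\<le>2 * K. \<beta> m r * z j ^ r * (poly cayley' (complex_of_real (t j))) ^ (2 * K))"
    proof -
      have "poly (P r) (complex_of_real (t j)) = z j ^ r * (poly cayley' (complex_of_real (t j))) ^ (2 * K)"
        if "r \<le> 2 * K" for r
      proof -
        have "poly (P r) (complex_of_real (t j)) = z j ^ r * ((poly cayley' (complex_of_real (t j))) ^ r *
            (poly cayley' (complex_of_real (t j))) ^ (2 * K - r))"
          using cayley_node(1)[OF z, of j] by (simp add: P_def t_def power_mult_distrib)
        then show ?thesis using that by (simp flip: power_add)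
      qed
      then show ?thesis unfolding poly_sum by (intro sum.cong) auto
    qed
    also have "\<dots> = b m j * complex_of_real ((1 + (t j)\<^sup>2) ^ K)"
      using cayley_node(2)[OF z, of j]
      by (simp add: power_mult power_mult_distrib b_def sum_distrib_right mult.assoc flip: t_def)
    finally have "complex_of_real (t j ^ m) = b m j * complex_of_real ((1 + (t j)\<^sup>2) ^ K)" .
    moreover have "complex_of_real ((1 + (t j)\<^sup>2) ^ K) \<noteq> 0" using one_plus_square_nz[of "t j"] by simp
    ultimately show ?thesis by (metis of_real_divide nonzero_mult_div_cancel_right)
  qed
  define wt :: "nat \<times> real \<Rightarrow> real" where "wt = (\<lambda>(j, y). c j y / (1 + (t j)\<^sup>2) ^ K)"
  define pt :: "nat \<times> real \<Rightarrow> real \<times> real" where "pt = (\<lambda>(j, y). (t j, y))"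
  define I where "I = Sigma {..<M} Z"
  have "finite I" using Z(1) by (simp add: I_def)
  moreover have "0 \<le> wt i" if "i \<in> I" for i
    using that Z(2) by (auto simp: I_def wt_def intro!: divide_nonneg_nonneg)
  ultimately obtain A w where Aw: "finite A" "\<And>x. x \<in> A \<Longrightarrow> 0 \<le> w x"
    "\<And>f :: _ \<Rightarrow> real. (\<Sum>x\<in>A. w x * f x) = (\<Sum>i\<in>I. wt i * f (pt i))"
    using atoms_of_indexed_family[of I wt pt] by blast
  have moment: "complex_of_real (\<Sum>x\<in>A. w x * (fst x ^ m * snd x ^ k)) =
      (\<Sum>r\<le>2 * K. complex_of_real (fejer_count n K r / real (Suc n)) * (\<beta> m r * V r k))"
    if "m \<le> K" "k \<le> K" for m k
  proof -
    have "(\<Sum>x\<in>A. w x * (fst x ^ m * snd x ^ k)) =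
        (\<Sum>j<M. \<Sum>y\<in>Z j. t j ^ m / (1 + (t j)\<^sup>2) ^ K * (c j y * y ^ k))"
      unfolding Aw(3) I_def using Z(1) by (subst sum.Sigma) (auto simp: wt_def pt_def mult_ac intro!: sum.cong)
    then have "complex_of_real (\<Sum>x\<in>A. w x * (fst x ^ m * snd x ^ k)) =
        (\<Sum>j<M. complex_of_real (t j ^ m / (1 + (t j)\<^sup>2) ^ K) * (\<Sum>y\<in>Z j. complex_of_real (c j y * y ^ k)))"
      by (simp only: of_real_sum of_real_mult sum_distrib_left)
    also have "\<dots> = (\<Sum>j<M. b m j * l j (monom 1 k))"
      using Z(3)[of "monom 1 k"] that by (intro sum.cong) (simp_all add: b degree_monom_eq poly_monom del: of_real_divide)
    also have "\<dots> = complex_of_real a * (\<Sum>j<M. b m j * L' (x1_poly (F j) * X2 ^ k))"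
      by (simp add: l_def lift2_monom sum_distrib_left mult_ac)
    also have "(\<Sum>j<M. b m j * L' (x1_poly (F j) * X2 ^ k)) = L' (x1_poly (\<Sum>j<M. smult (b m j) (F j)) * X2 ^ k)"
      by (rule functional_x1_sum[OF pos', symmetric])
    also have "(\<Sum>j<M. smult (b m j) (F j)) = (\<Sum>r\<le>2 * K. smult (of_nat M * complex_of_real (fejer_count n K r) * \<beta> m r)
      ((cayley * cayley') ^ R * P r))"
      unfolding F_def b_def z_def P_def by (rule sum_fejer_squares[OF M(1) n_def])
    also have "L' (x1_poly \<dots> * X2 ^ k) = (\<Sum>r\<le>2 * K. of_nat M * complex_of_real (fejer_count n K r) * \<beta> m r *
       L' (x1_poly ((cayley * cayley') ^ R * P r) * X2 ^ k))"
      by (rule functional_x1_sum[OF pos'])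
    also have "\<dots> = (\<Sum>r\<le>2 * K. of_nat M * complex_of_real (fejer_count n K r) * \<beta> m r * V r k)"
      unfolding V_def L'[symmetric] X1_minus_i_mult_conj2 x1_poly_mult x1_poly_power by (simp only: mult.assoc)
    also have "complex_of_real a * \<dots> = (\<Sum>r\<le>2 * K. complex_of_real (fejer_count n K r / real (Suc n)) * (\<beta> m r * V r k))"
      unfolding sum_distrib_left
    proof (intro sum.cong refl)
      fix r
      have "complex_of_real a * of_nat M * of_real (fejer_count n K r) = complex_of_real (a * real M * fejer_count n K r)"
        by simp
      also have "a * real M * fejer_count n K r = fejer_count n K r / real (Suc n)" using M(3) by (simp add: a_def)
      finally show "complex_of_real a * (of_nat M * complex_of_real (fejer_count n K r) * \<beta> m r * V r k) =
         complex_of_real (fejer_count n K r / real (Suc n)) * (\<beta> m r * V r k)"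
        by (simp only: mult.assoc[symmetric])
    qed
    finally show ?thesis .
  qed
  have "\<bar>(\<Sum>x\<in>A. w x * (fst x ^ m * snd x ^ k)) - Re (L (x1_poly (monom 1 m) * X2 ^ k))\<bar> < e"
    if "m \<le> K" "k \<le> K" for m k
  proof -
    have "\<bar>(\<Sum>x\<in>A. w x * (fst x ^ m * snd x ^ k)) - Re (L (x1_poly (monom 1 m) * X2 ^ k))\<bar> \<le>
        cmod (complex_of_real (\<Sum>x\<in>A. w x * (fst x ^ m * snd x ^ k)) - L (x1_poly (monom 1 m) * X2 ^ k))"
      using abs_Re_le_cmod[of "complex_of_real (\<Sum>x\<in>A. w x * (fst x ^ m * snd x ^ k)) - L (x1_poly (monom 1 m) * X2 ^ k)"]
      by simp
    also have "\<dots> = cmod (\<Sum>r\<le>2 * K. complex_of_real (fejer_count n K r / real (Suc n) - 1) * (\<beta> m r * V r k))"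
      unfolding moment[OF that] LV[OF that(1)] sum_subtractf[symmetric] by (simp add: algebra_simps)
    also have "\<dots> \<le> (\<Sum>r\<le>2 * K. 2 * real K / real (Suc n) * cmod (\<beta> m r * V r k))"
    proof (rule sum_norm_le)
      fix r assume "r \<in> {..2 * K}"
      then have "\<bar>fejer_count n K r - real (Suc n)\<bar> \<le> 2 * real K"
        using fejer_count_bounds[of r K n] n by simp
      moreover have "fejer_count n K r / real (Suc n) - 1 = (fejer_count n K r - real (Suc n)) / real (Suc n)"
        by (simp add: field_simps)
      ultimately have "\<bar>fejer_count n K r / real (Suc n) - 1\<bar> \<le> 2 * real K / real (Suc n)"
        by (simp add: abs_divide divide_right_mono)
      then show "cmod (complex_of_real (fejer_count n K r / real (Suc n) - 1) * (\<beta> m r * V r k)) \<le>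
         2 * real K / real (Suc n) * cmod (\<beta> m r * V r k)"
        unfolding norm_mult[of "complex_of_real _"] norm_of_real by (rule mult_right_mono) simp
    qed
    also have "\<dots> = 2 * real K / real (Suc n) * (\<Sum>r\<le>2 * K. cmod (\<beta> m r * V r k))"
      by (rule sum_distrib_left[symmetric])
    also have "\<dots> \<le> 2 * real K / real (Suc n) * C" by (intro mult_left_mono C that) simp
    also have "\<dots> < e" using small by simp
    finally show ?thesis .
  qed
  then show ?thesis using Aw(1,2) by blast
qed

section \<open>From determinate functionals to a measure in the plane\<close>

text \<open>
It is enough to approximate $p(x_1)q$. With $g$ from \<open>determinate_approximation\<close> for $L_q$, the polynomial $p-p(\mathrm{i})g$
is divisible by $x-\mathrm{i}$, and the error $p(\mathrm{i})g(x_1)q$ is small, as its squared weighted seminorm is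
a multiple of $L_q(g\overline{g})$.
\<close>

lemma resolvent_dense_if_determinate:
  assumes span: "module.span scale2 {x1_poly p * q | p q. q \<in> Q} = UNIV"
    and pos: "positive2 L"
    and det: "\<And>q. q \<in> Q \<Longrightarrow> determinate1 (\<lambda>p. L (x1_poly p * (X2\<^sup>2 + 1) * (q * conj2 q)))"
  shows "resolvent_dense L"
proof -
  interpret W: star_functional const2 conj2 "weighted L" by (rule positive2_weighted[OF pos])
  interpret V: vector_space scale2 by (rule vector_space_scale2)
  define D where "D = {f. \<forall>d>0. \<exists>h. W.nrm (X1_minus_i * h - f) < d}"
  have "V.subspace D"
  proof (rule V.subspaceI)
    show "0 \<in> D" unfolding D_def by (auto intro!: exI[of _ 0])
  next
    fix f g assume fg: "f \<in> D" "g \<in> D"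
    show "f + g \<in> D" unfolding D_def
    proof (intro CollectI allI impI)
      fix d :: real assume "d > 0"
      then have "d / 2 > 0" by simp
      then obtain h k where "W.nrm (X1_minus_i * h - f) < d / 2" "W.nrm (X1_minus_i * k - g) < d / 2"
        using fg unfolding D_def by blast
      then have "W.nrm (X1_minus_i * (h + k) - (f + g)) < d"
        using W.nrm_triangle[of "X1_minus_i * h - f" "X1_minus_i * k - g"] by (simp add: algebra_simps)
      then show "\<exists>h. W.nrm (X1_minus_i * h - (f + g)) < d" ..
    qed
  next
    fix c f assume f: "f \<in> D"
    show "scale2 c f \<in> D" unfolding D_def
    proof (intro CollectI allI impI)
      fix d :: real assume "d > 0"
      then have "d / (cmod c + 1) > 0" by (simp add: add_nonneg_pos)
      then obtain h where h: "W.nrm (X1_minus_i * h - f) < d / (cmod c + 1)" using f unfolding D_def by blast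
      have "X1_minus_i * (const2 c * h) - scale2 c f = const2 c * (X1_minus_i * h - f)"
        by (simp add: scale2_def smult_diff_right)
      then have "W.nrm (X1_minus_i * (const2 c * h) - scale2 c f) = cmod c * W.nrm (X1_minus_i * h - f)" by (simp only: W.nrm_scale)
      also have "\<dots> \<le> (cmod c + 1) * W.nrm (X1_minus_i * h - f)" by (simp add: mult_right_mono)
      also have "\<dots> < d" using h by (simp add: pos_less_divide_eq add_nonneg_pos mult.commute)
      finally show "\<exists>h. W.nrm (X1_minus_i * h - scale2 c f) < d" by blast
    qed
  qed
  moreover have "{x1_poly p * q | p q. q \<in> Q} \<subseteq> D"
  proof clarify
    fix p q assume q: "q \<in> Q"
    show "x1_poly p * q \<in> D" unfolding D_def
    proof (intro CollectI allI impI)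
      fix d :: real assume "d > 0"
      define d' where "d' = d / (cmod (poly p \<i>) + 1)"
      have d': "d' > 0" using \<open>d > 0\<close> by (simp add: d'_def add_nonneg_pos)
      then obtain g where g: "poly g \<i> = 1" "Re (L (x1_poly (g * conj1 g) * (X2\<^sup>2 + 1) * (q * conj2 q))) < d'\<^sup>2"
        using determinate_approximation[OF det[OF q], of "d'\<^sup>2"] by auto
      have eq: "x1_poly (g * conj1 g) * (X2\<^sup>2 + 1) * (q * conj2 q) = (X2\<^sup>2 + 1) * ((x1_poly g * q) * conj2 (x1_poly g * q))"
        by (simp only: x1_poly_mult conj2_mult conj2_x1_poly mult_ac)
      have "(W.nrm (x1_poly g * q))\<^sup>2 < d'\<^sup>2" using g(2) unfolding W.nrm_sq weighted_def eq .
      then have less: "W.nrm (x1_poly g * q) < d'" using d' by (simp add: power_less_imp_less_base)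
      have "poly (p - smult (poly p \<i>) g) \<i> = 0" using g(1) by simp
      then obtain k where k: "p - smult (poly p \<i>) g = [:-\<i>, 1:] * k" by (metis dvdE poly_eq_0_iff_dvd)
      have "x1_poly p - const2 (poly p \<i>) * x1_poly g = X1_minus_i * x1_poly k"
        using arg_cong[OF k, of x1_poly] by (simp add: x1_poly_def X1_minus_i_def)
      then have "X1_minus_i * (x1_poly k * q) = (x1_poly p - const2 (poly p \<i>) * x1_poly g) * q"
        by (simp only: mult.assoc)
      then have "X1_minus_i * (x1_poly k * q) - x1_poly p * q = - (const2 (poly p \<i>) * (x1_poly g * q))"
        by (simp add: algebra_simps)
      then have "W.nrm (X1_minus_i * (x1_poly k * q) - x1_poly p * q) = cmod (poly p \<i>) * W.nrm (x1_poly g * q)"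
        by (simp only: W.nrm_minus W.nrm_scale)
      also have "\<dots> \<le> (cmod (poly p \<i>) + 1) * W.nrm (x1_poly g * q)" by (simp add: mult_right_mono)
      also have "\<dots> < d" using less by (simp add: d'_def pos_less_divide_eq add_nonneg_pos mult.commute)
      finally show "\<exists>h. W.nrm (X1_minus_i * h - x1_poly p * q) < d" by blast
    qed
  qed
  ultimately have "D = UNIV" using V.span_minimal[of "{x1_poly p * q | p q. q \<in> Q}" D] span by auto
  then show ?thesis unfolding resolvent_dense_def D_def by blast
qed

lemma eval2_monomial: "eval2 (x1_poly (monom 1 m) * X2 ^ n) z = complex_of_real (fst z ^ m * snd z ^ n)"
proof -
  have "eval2 (X2 ^ n) z = complex_of_real (snd z) ^ n"
    by (simp add: eval2_def X2_def) 
  then show ?thesis by (cases z) (simp add: poly_monom)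
qed

lemma poly2_as_sum_of_monomials:
  "f = (\<Sum>n\<le>degree f. \<Sum>m\<le>degree (coeff f n). scale2 (coeff (coeff f n) m) (x1_poly (monom 1 m) * X2 ^ n))"
proof -
  have "(\<Sum>m\<le>degree a. scale2 (coeff a m) (x1_poly (monom 1 m) * X2 ^ n)) = monom a n" for a :: "complex poly" and n
  proof -
    have "monom a n = monom (\<Sum>m\<le>degree a. smult (coeff a m) (monom 1 m)) n"
      by (simp add: smult_monom poly_as_sum_of_monoms)
    also have "\<dots> = (\<Sum>m\<le>degree a. monom (smult (coeff a m) (monom 1 m)) n)" by (rule monom_sum)
    also have "\<dots> = (\<Sum>m\<le>degree a. scale2 (coeff a m) (x1_poly (monom 1 m) * X2 ^ n))"
      by (intro sum.cong refl) (simp add: scale2_def x1_poly_def X2_def monom_altdef[of _ n])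
    finally show ?thesis by simp
  qed
  then show ?thesis by (simp add: poly_as_sum_of_monoms)
qed

lemma represents2I:
  assumes lin: "Vector_Spaces.linear scale2 (*) L"
    and \<mu>: "sets \<mu> = sets borel" "\<And>m n. integrable \<mu> (\<lambda>z. fst z ^ m * snd z ^ n)"
    and moments: "\<And>m n. L (x1_poly (monom 1 m) * X2 ^ n) = complex_of_real (LINT z|\<mu>. fst z ^ m * snd z ^ n)"
  shows "represents2 \<mu> L"
proof -
  interpret L: Vector_Spaces.linear scale2 "(*)" L by fact
  define P where "P f \<longleftrightarrow> integrable \<mu> (eval2 f) \<and> L f = (LINT z|\<mu>. eval2 f z)" for f
  have zero: "P 0" using L.zero by (simp add: P_def eval2_def[abs_def])
  have add: "P (f + g)" if "P f" "P g" for f g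
  proof -
    have "eval2 (f + g) = (\<lambda>z. eval2 f z + eval2 g z)" by (rule ext) simp
    then show ?thesis using that by (simp add: P_def L.add)
  qed
  have sum: "P (\<Sum>i\<in>I. f i)" if "\<And>i. i \<in> I \<Longrightarrow> P (f i)" for I and f :: "nat \<Rightarrow> complex poly poly"
    using that by (induction I rule: infinite_finite_induct) (auto intro: zero add)
  have monomial: "P (scale2 c (x1_poly (monom 1 m) * X2 ^ n))" for c m n
  proof -
    have "integrable \<mu> (\<lambda>z. complex_of_real (fst z ^ m * snd z ^ n))" by (intro integrable_of_real \<mu>)
    moreover have "(LINT z|\<mu>. complex_of_real (fst z ^ m * snd z ^ n)) = L (x1_poly (monom 1 m) * X2 ^ n)"
      unfolding moments by (rule integral_complex_of_real)
    ultimately show ?thesis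
      unfolding P_def eval2_simps(3) eval2_monomial L.scale by simp
  qed
  have "P f" for f
    by (subst poly2_as_sum_of_monomials) (intro sum monomial)
  then show ?thesis using \<mu> by (simp add: represents2_def P_def finite_moment_measures2_def)
qed

theorem theorem19:
  fixes Q :: "complex poly poly set"
    and L :: "complex poly poly \<Rightarrow> complex"
  assumes "module.span scale2 {x1_poly p * q | p q. q \<in> Q} = UNIV"
    and "Vector_Spaces.linear scale2 (*) L"
    and "positive_functional L"
    and "\<And>q. q \<in> Q \<Longrightarrow>
           determinate1 (\<lambda>p. L (x1_poly p * (X2 ^ 2 + 1) * (q * conj2 q)))"
  shows "moment_functional2 L"
proof -
  interpret lin: Vector_Spaces.linear scale2 "(*)" L by fact
  have pos2: "positive2 L"
    by (rule positive2I) (use assms(3) lin.add lin.scale in \<open>auto simp: positive_functional_def scale2_def\<close>)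
  interpret star_functional const2 conj2 L by (rule pos2)
  have resolvents: "\<exists>L'. positive2 L' \<and> (\<forall>f. L' ((X1_minus_i * conj2 X1_minus_i) ^ n * f) = L f)" for n
    using adjoin_resolvent_power[OF pos2 resolvent_dense_if_determinate[OF assms(1) pos2 assms(4)]] by blast
  have "conj2 (X2 ^ n) = X2 ^ n" for n by (induction n) (simp_all add: conj2_mult conj2_X2)
  then have "conj2 (x1_poly (monom 1 m) * X2 ^ n) = x1_poly (monom 1 m) * X2 ^ n" for m n
    by (simp add: conj2_mult conj2_x1_poly map_poly_monom)
  then have real: "L (x1_poly (monom 1 m) * X2 ^ n) = complex_of_real (Re (L (x1_poly (monom 1 m) * X2 ^ n)))" for m n
    using hermitian[of "x1_poly (monom 1 m) * X2 ^ n"] by (simp add: complex_eq_iff)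
  show ?thesis
  \<comment> \<open>A functional of total mass zero vanishes by Cauchy-Schwarz; otherwise the mass can be normalized.\<close>
  proof (cases "L 1 = 0")
    case True
    then have "nrm 1 = 0" by (simp add: nrm_def)
    then have "L f = 0" for f using eq_0_if_nrm_0[of 1 f] by simp
    then have "represents2 (null_measure borel) L" by (intro represents2I assms) (auto simp: measurable_monomial)
    then show ?thesis unfolding moment_functional2_def ..
  next
    case False
    have one: "x1_poly (monom 1 0) * X2 ^ 0 = 1" by (simp add: x1_poly_def)
    have "L 1 \<in> \<real>\<^sub>\<ge>\<^sub>0" using pos[of 1] by simp
    then have s00: "Re (L (x1_poly (monom 1 0) * X2 ^ 0)) > 0"
      using False unfolding one by (auto simp: complex_nonneg_Reals_iff complex_eq_iff)
    obtain \<mu> :: "(real \<times> real) measure" where \<mu>: "sets \<mu> = sets borel"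
      "\<And>m n. integrable \<mu> (\<lambda>z. fst z ^ m * snd z ^ n)"
      "\<And>m n. (LINT z|\<mu>. fst z ^ m * snd z ^ n) = Re (L (x1_poly (monom 1 m) * X2 ^ n))"
      using limit_of_atomic_measures[of "\<lambda>m n. Re (L (x1_poly (monom 1 m) * X2 ^ n))", OF s00 atomic_approximation[OF pos2 resolvents]]
      by blast
    have "represents2 \<mu> L"
      by (rule represents2I[OF assms(2) \<mu>(1,2)]) (use real \<mu>(3) in simp)
    then show ?thesis unfolding moment_functional2_def ..
  qed
qed

end
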